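(* Let $k\geq 1$ and let $\bar\lambda=(\lambda_1,\dots,\lambda_k)\in\mathbb{Z}^k$ be a vector of $k$ coprime integers. Then for every finite set $A\subset\mathbb{Z}$, $$|\lambda_1\cdot A+\dots+\lambda_k\cdot A|\geq (|\lambda_1|+\dots+|\lambda_k|)\,|A|-o(|A|),$$ with the error term depending on $\bar\lambda$ only. That is, there is a function $f_{\bar\lambda}:\mathbb{N}\to\mathbb{R}$, depending only on $\bar\lambda$, with $f_{\bar\lambda}(n)/n\to 0$ as $n\to\infty$, such that $|\lambda_1\cdot A+\dots+\lambda_k\cdot A|\geq (|\lambda_1|+\dots+|\lambda_k|)|A|-f_{\bar\lambda}(|A|)$ for every finite set $A\subset\mathbb{Z}$.
   Context: For sets $A,B\subset\mathbb{Z}$, the sumset is $A+B=\{a+b: a\in A,\ b\in B\}$ (and similarly for several summands). For an integer $\lambda$, the dilate of $A$ by $\lambda$ is $\lambda\cdot A=\{\lambda a: a\in A\}$. Integers $\lambda_1,\dots,\lambda_k$ are coprime if $\gcd(\lambda_1,\dots,\lambda_k)=1$, where $\gcd(\lambda_1,\dots,\lambda_k)=\max\{d\in\mathbb{N}: d\mid\lambda_i \text{ for } i=1,\dots,k\}$ (joint, not pairwise, coprimality). *)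

theory Defs
  imports "HOL-Analysis.Analysis" "HOL-Library.Set_Algebras"
begin

text \<open>
  Sums of sets (binary and iterated) are those of \<open>HOL-Library.Set_Algebras\<close>, where \<open>+\<close>
  on sets is the Minkowski sum \<open>{a + b | a b. a \<in> A \<and> b \<in> B}\<close> with neutral element \<open>{0}\<close>,
  and \<open>\<lambda> *o A\<close> is the dilate \<open>{\<lambda> * a | a. a \<in> A}\<close>.
\<close>

end

theory Submission
  imports Defs "HOL-Computational_Algebra.Primes" "HOL-Real_Asymp.Real_Asymp"
begin

text \<open>
  Let \<open>S(A)\<close> be the sum of the dilates and \<open>L = \<Sum>\<bar>\<lambda>\<^sub>i\<bar>\<close>. If all classes of \<open>A\<close> modulo some \<open>d\<close> are saturated,
  i.e. meet every subclass modulo \<open>d * M\<close> where all \<open>\<lambda>\<^sub>i\<close> divide \<open>M\<close>, then sums of dilates of these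
  classes have the expected size: for coprime \<open>p, q\<close> the set \<open>p \<cdot> U + q \<cdot> V\<close> splits into \<open>\<bar>p * q\<bar>\<close> disjoint pieces
  \<open>p \<cdot> U\<^sub>i + q \<cdot> V\<^sub>j\<close>, one for each pair of classes modulo \<open>q\<close> and \<open>p\<close>. As \<open>S\<close> does not decrease the number of
  residues modulo \<open>d\<close>, a greedy choice of residues gives \<open>\<bar>S(A)\<bar> \<ge> L * \<bar>A\<bar> - C\<close>.

  To reduce to that case, assume \<open>\<bar>S(A)\<bar> < L * \<bar>A\<bar>\<close>. Then \<open>A\<close> has small difference set (Ruzsa), and the
  \<open>t\<close>-fold sums of \<open>A\<close> grow polynomially in \<open>t\<close> (Petridis, Chang). Consequently all classes of \<open>A\<close>
  have at most a constant times the average size, and \<open>A\<close> cannot fail to be mostly saturated along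
  a long chain of moduli without forcing exponential growth. Hence some bounded number of
  classes modulo some \<open>d\<close> contains \<open>A\<close>, and deleting the unsaturated ones costs only \<open>\<epsilon> * \<bar>A\<bar>\<close> elements.
\<close>

section \<open>Sumset estimates\<close>

lemma card_plus_mono_left:
  fixes U V :: "int set"
  assumes "finite U" "finite V" "V \<noteq> {}"
  shows "card U \<le> card (U + V)"
proof -
  obtain v where v: "v \<in> V" using assms by auto
  have "card U = card ((\<lambda>u. u + v) ` U)" by (simp add: card_image)
  also have "\<dots> \<le> card (U + V)"
    using assms v by (intro card_mono finite_set_plus) (auto intro: set_plus_intro)
  finally show ?thesis .
qed

lemma card_plus_mono_right:
  fixes U V :: "int set"
  assumes "finite U" "finite V" "U \<noteq> {}"
  shows "card V \<le> card (U + V)"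
  using card_plus_mono_left[of V U] assms by (simp add: add.commute)

lemma card_plus_le:
  fixes U V :: "int set"
  assumes "finite U" "finite V"
  shows "card (U + V) \<le> card U * card V"
proof -
  have "U + V = (\<lambda>(u, v). u + v) ` (U \<times> V)" by (auto simp: set_plus_def)
  then have "card (U + V) \<le> card (U \<times> V)" using assms by (metis card_image_le finite_cartesian_product)
  then show ?thesis by (simp add: card_cartesian_product)
qed

text \<open>The translates \<open>Min U + V\<close> and \<open>U + Max V\<close> both lie in
  \<open>U + V\<close> and share only the element \<open>Min U + Max V\<close>.\<close>

lemma card_plus_int_ge:
  fixes U V :: "int set"
  assumes "finite U" "finite V" "U \<noteq> {}" "V \<noteq> {}"
  shows "card U + card V \<le> card (U + V) + 1"
proof -
  define P where "P = (\<lambda>v. Min U + v) ` V"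
  define Q where "Q = (\<lambda>u. u + Max V) ` U"
  have "P \<inter> Q \<subseteq> {Min U + Max V}"
  proof
    fix x assume "x \<in> P \<inter> Q"
    then obtain u v where "x = Min U + v" "x = u + Max V" "u \<in> U" "v \<in> V"
      unfolding P_def Q_def by blast
    moreover have "Min U \<le> u" "v \<le> Max V" using assms \<open>u \<in> U\<close> \<open>v \<in> V\<close> by auto
    ultimately show "x \<in> {Min U + Max V}" by auto
  qed
  then have i: "card (P \<inter> Q) \<le> 1" using card_mono[of "{Min U + Max V}"] by fastforce
  have "card P + card Q = card (P \<union> Q) + card (P \<inter> Q)"
    using assms by (intro card_Un_Int) (auto simp: P_def Q_def)
  moreover have "card P = card V" "card Q = card U" by (auto simp: P_def Q_def card_image)
  moreover have "card (P \<union> Q) \<le> card (U + V)"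
    using assms by (intro card_mono finite_set_plus)
      (auto simp: P_def Q_def intro!: set_plus_intro Min_in Max_in)
  ultimately show ?thesis using i by linarith
qed

text \<open>Ruzsa's triangle inequality. Fix one representation \<open>e = y - z\<close> of every
  difference and send \<open>(x, e)\<close> to \<open>(y + x, x + z)\<close>. The difference of the
  two coordinates gives back \<open>e\<close>, hence \<open>y\<close>, \<open>z\<close> and finally
  \<open>x\<close>.\<close>

lemma ruzsa_triangle:
  fixes X Y Z :: "int set"
  assumes "finite X" "finite Y" "finite Z"
  shows "card X * card (Y + uminus ` Z) \<le> card (Y + X) * card (X + Z)"
proof -
  have "\<forall>e\<in>Y + uminus ` Z. \<exists>p. fst p \<in> Y \<and> snd p \<in> Z \<and> e = fst p - snd p"
    by (auto simp: set_plus_def)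
  then obtain p where p: "\<And>e. e \<in> Y + uminus ` Z \<Longrightarrow> fst (p e) \<in> Y \<and> snd (p e) \<in> Z \<and> e = fst (p e) - snd (p e)"
    by metis
  define F where "F = (\<lambda>(x, e). (fst (p e) + x, x + snd (p e)))"
  have "inj_on F (X \<times> (Y + uminus ` Z))"
  proof (rule inj_onI, clarify)
    fix x e x' e' assume *: "x \<in> X" "e \<in> Y + uminus ` Z" "x' \<in> X" "e' \<in> Y + uminus ` Z" "F (x, e) = F (x', e')"
    then have "fst (p e) + x = fst (p e') + x'" "x + snd (p e) = x' + snd (p e')" by (auto simp: F_def)
    moreover from this have "e = e'" using p[OF *(2)] p[OF *(4)] by linarith
    ultimately show "x = x' \<and> e = e'" by auto
  qed
  moreover have "F ` (X \<times> (Y + uminus ` Z)) \<subseteq> (Y + X) \<times> (X + Z)"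
    using p by (auto simp: F_def intro!: set_plus_intro)
  ultimately have "card (X \<times> (Y + uminus ` Z)) \<le> card ((Y + X) \<times> (X + Z))"
    using assms by (intro card_inj_on_le[of F]) (auto intro: finite_set_plus)
  then show ?thesis by (simp add: card_cartesian_product)
qed

text \<open>Petridis's inequality, where \<open>X\<close> attains the least expansion ratio
  \<open>K\<close> among its subsets. When \<open>c\<close> joins \<open>C\<close>, the right side
  grows by \<open>K * (card X - card Z)\<close>. The left side gains at most
  \<open>card (X + B) - card (Z + B)\<close>, as \<open>Z + B + c\<close> is already covered, and
  minimality bounds \<open>card (Z + B)\<close> from below.\<close>

lemma petridis:
  fixes X B C :: "int set" and K :: real
  assumes fin: "finite X" "finite B" "finite C"
    and XB: "card (X + B) \<le> K * card X"
    and min: "\<And>Z. Z \<subseteq> X \<Longrightarrow> K * card Z \<le> card (Z + B)"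
  shows "card (X + B + C) \<le> K * card (X + C)"
  using fin(3)
proof (induction C rule: finite_induct)
  case empty
  then show ?case by (simp add: set_plus_def)
next
  case (insert c C)
  define Z where "Z = {x \<in> X. x + c \<in> X + C}"
  have Z: "Z \<subseteq> X" "finite Z" using fin by (auto simp: Z_def)
  have finXC: "finite (X + C)" "finite (X + B + C)" "finite (X + B)" "finite (Z + B)"
    using insert fin Z by (auto intro!: finite_set_plus)
  have eq: "X + insert c C = (X + C) \<union> (\<lambda>x. x + c) ` (X - Z)"
    by (auto simp: set_plus_def Z_def)
  have "(X + C) \<inter> (\<lambda>x. x + c) ` (X - Z) = {}" by (auto simp: Z_def)
  then have "card (X + insert c C) = card (X + C) + card ((\<lambda>x. x + c) ` (X - Z))"
    using finXC fin eq by (simp add: card_Un_disjoint)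
  also have "card ((\<lambda>x. x + c) ` (X - Z)) = card X - card Z"
    using Z fin by (simp add: card_image card_Diff_subset)
  finally have c1: "real (card (X + insert c C)) = card (X + C) + (real (card X) - card Z)"
    using card_mono[OF fin(1) Z(1)] by simp
  have "X + B + insert c C \<subseteq> (X + B + C) \<union> (\<lambda>x. x + c) ` ((X + B) - (Z + B))"
  proof
    fix y assume "y \<in> X + B + insert c C"
    then obtain x b e where y: "y = x + b + e" "x \<in> X" "b \<in> B" "e \<in> insert c C"
      by (auto simp: set_plus_def)
    show "y \<in> (X + B + C) \<union> (\<lambda>x. x + c) ` ((X + B) - (Z + B))"
    proof (cases "y \<in> X + B + C")
      case False
      then have e: "e = c" using y by (auto simp: set_plus_def)
      have "x + b \<notin> Z + B"
      proof
        assume "x + b \<in> Z + B"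
        then obtain z b' where zb: "x + b = z + b'" "z \<in> Z" "b' \<in> B" by (auto simp: set_plus_def)
        then obtain x' e' where "z + c = x' + e'" "x' \<in> X" "e' \<in> C" by (auto simp: Z_def set_plus_def)
        then have "y = x' + b' + e'" using y e zb by simp
        then show False using False \<open>x' \<in> X\<close> \<open>e' \<in> C\<close> zb by (auto intro!: set_plus_intro)
      qed
      moreover have "x + b \<in> X + B" using y by (auto intro: set_plus_intro)
      ultimately show ?thesis using y e by auto
    qed auto
  qed
  then have "card (X + B + insert c C) \<le> card ((X + B + C) \<union> (\<lambda>x. x + c) ` ((X + B) - (Z + B)))"
    using finXC by (intro card_mono) auto
  also have "\<dots> \<le> card (X + B + C) + card ((\<lambda>x. x + c) ` ((X + B) - (Z + B)))"
    by (rule card_Un_le)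
  also have "card ((\<lambda>x. x + c) ` ((X + B) - (Z + B))) = card (X + B) - card (Z + B)"
    using Z finXC by (simp add: card_image card_Diff_subset set_plus_mono2)
  finally have "real (card (X + B + insert c C)) \<le> card (X + B + C) + (real (card (X + B)) - card (Z + B))"
    using card_mono[OF finXC(3), of "Z + B"] Z(1) by (simp add: set_plus_mono2)
  moreover have "K * card (X + insert c C) = K * card (X + C) + K * card X - K * card Z"
    unfolding c1 by (simp add: algebra_simps)
  ultimately show ?case using insert.IH XB min[OF Z(1)] by linarith
qed

text \<open>Take \<open>X\<close> minimising the expansion ratio over the nonempty subsets of
  \<open>A\<close>; this minimum is at most the ratio of \<open>A\<close> itself.\<close>

lemma petridis_exists:
  fixes A B :: "int set"
  assumes "finite A" "finite B" "A \<noteq> {}"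
  obtains X where "X \<subseteq> A" "X \<noteq> {}"
    "\<And>C. finite C \<Longrightarrow> real (card (X + B + C)) \<le> real (card (A + B)) / real (card A) * real (card (X + C))"
proof -
  define rat where "rat = (\<lambda>X::int set. real (card (X + B)) / real (card X))"
  define X where "X = arg_min_on rat (Pow A - {{}})"
  have f: "finite (Pow A - {{}})" "Pow A - {{}} \<noteq> {}" using assms by auto
  have X: "X \<in> Pow A - {{}}" unfolding X_def using arg_min_if_finite(1)[OF f] .
  have le: "rat X \<le> rat Z" if "Z \<in> Pow A - {{}}" for Z
    unfolding X_def by (rule arg_min_least[OF f that])
  have finX: "finite X" using X assms finite_subset by auto
  have cX: "card X > 0" using X finX by (auto simp: card_gt_0_iff)
  show thesis
  proof (rule that[of X])
    fix C :: "int set" assume C: "finite C"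
    have "card (X + B + C) \<le> rat X * card (X + C)"
    proof (rule petridis[OF finX assms(2) C])
      show "card (X + B) \<le> rat X * card X" using cX by (simp add: rat_def)
      fix Z assume Z: "Z \<subseteq> X"
      show "rat X * card Z \<le> card (Z + B)"
      proof (cases "Z = {}")
        case False
        then have "card Z > 0" using Z finX finite_subset by (auto simp: card_gt_0_iff)
        moreover have "rat X \<le> rat Z" using le Z X False by blast
        ultimately show ?thesis by (simp add: rat_def pos_le_divide_eq)
      qed simp
    qed
    also have "\<dots> \<le> rat A * card (X + C)"
      using le[of A] assms by (intro mult_right_mono) auto
    finally show "real (card (X + B + C)) \<le> real (card (A + B)) / real (card A) * real (card (X + C))"
      by (simp add: rat_def)
  qed (use X in auto)
qed

section \<open>Iterated sumsets and their polynomial growth\<close>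

primrec nsum :: "nat \<Rightarrow> int set \<Rightarrow> int set" where
  "nsum 0 A = {0}"
| "nsum (Suc n) A = A + nsum n A"

lemma finite_nsum [simp]: "finite A \<Longrightarrow> finite (nsum n A)"
  by (induction n) (auto intro: finite_set_plus)

lemma nsum_add: "nsum (m + n) A = nsum m A + nsum n A"
  by (induction m) (auto simp: add.assoc simp flip: set_zero)

lemma nsum_1 [simp]: "nsum (Suc 0) A = A"
  by (simp flip: set_zero)

lemma nsum_uminus: "nsum n (uminus ` A) = uminus ` nsum n A"
proof (induction n)
  case (Suc n)
  have "- (a + b) \<in> uminus ` A + uminus ` nsum n A" if "a \<in> A" "b \<in> nsum n A" for a b
    using that set_plus_intro[of "- a" "uminus ` A" "- b" "uminus ` nsum n A"] by simp
  moreover have "- a + - b \<in> uminus ` (A + nsum n A)" if "a \<in> A" "b \<in> nsum n A" for a b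
    using that by (intro image_eqI[of _ _ "a + b"]) auto
  ultimately have "uminus ` A + uminus ` nsum n A = uminus ` (A + nsum n A)"
    by (fastforce elim!: set_plus_elim)
  then show ?case using Suc by simp
qed simp

lemma card_nsum_uminus: "card (nsum n (uminus ` A)) = card (nsum n A)"
  by (simp add: nsum_uminus card_image)

text \<open>A \<open>t\<close>-fold sum is determined by how often each element of \<open>Y\<close>
  occurs in it, which is at most \<open>t\<close> times.\<close>

lemma card_nsum_le:
  assumes "finite Y"
  shows "card (nsum t Y) \<le> (t + 1) ^ card Y"
proof -
  have "nsum t Y \<subseteq> (\<lambda>f. \<Sum>y\<in>Y. int (f y) * y) ` (Y \<rightarrow>\<^sub>E {..t})"
  proof (induction t)
    case 0
    then show ?case by (auto intro!: image_eqI[of _ _ "restrict (\<lambda>_. 0) Y"])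
  next
    case (Suc t)
    show ?case
    proof
      fix z assume "z \<in> nsum (Suc t) Y"
      then obtain a f where z: "z = a + (\<Sum>y\<in>Y. int (f y) * y)" "a \<in> Y" "f \<in> Y \<rightarrow>\<^sub>E {..t}"
        using Suc by (force simp: set_plus_def)
      define g where "g = f(a := f a + 1)"
      have "g \<in> Y \<rightarrow>\<^sub>E {..Suc t}" using z by (force simp: g_def PiE_iff extensional_def)
      moreover have "(\<Sum>y\<in>Y. int (g y) * y) = (\<Sum>y\<in>Y. int (f y) * y + (if y = a then a else 0))"
        by (intro sum.cong) (auto simp: g_def algebra_simps)
      then have "(\<Sum>y\<in>Y. int (g y) * y) = z" using z assms by (simp add: sum.distrib)
      ultimately show "z \<in> (\<lambda>f. \<Sum>y\<in>Y. int (f y) * y) ` (Y \<rightarrow>\<^sub>E {..Suc t})" by blast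
    qed
  qed
  then have "card (nsum t Y) \<le> card ((\<lambda>f. \<Sum>y\<in>Y. int (f y) * y) ` (Y \<rightarrow>\<^sub>E {..t}))"
    using assms by (intro card_mono finite_imageI finite_PiE) auto
  also have "\<dots> \<le> card (Y \<rightarrow>\<^sub>E {..t})"
    using assms by (intro card_image_le finite_PiE) auto
  also have "\<dots> = (t + 1) ^ card Y" using assms by (simp add: card_PiE)
  finally show ?thesis .
qed

text \<open>Ruzsa's covering lemma, run greedily: if \<open>q\<close> is not covered by
  \<open>Y + (X - X)\<close>, then \<open>q + X\<close> is disjoint from \<open>Y + X\<close>, so
  \<open>q\<close> can join \<open>Y\<close> while the translates of \<open>X\<close> stay
  disjoint.\<close>

lemma ruzsa_covering:
  fixes Q X :: "int set"
  assumes "finite Q" "finite X" "X \<noteq> {}"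
  shows "\<exists>Y\<subseteq>Q. card (Y + X) = card Y * card X \<and> Q \<subseteq> Y + (X + uminus ` X)"
  using assms(1)
proof (induction Q rule: finite_induct)
  case empty
  then show ?case by (simp add: set_plus_def)
next
  case (insert q Q)
  then obtain Y where Y: "Y \<subseteq> Q" "card (Y + X) = card Y * card X" "Q \<subseteq> Y + (X + uminus ` X)"
    by blast
  show ?case
  proof (cases "q \<in> Y + (X + uminus ` X)")
    case True
    then show ?thesis using Y by (intro exI[of _ Y]) auto
  next
    case q: False
    have finY: "finite Y" using Y insert finite_subset by auto
    have eq: "insert q Y + X = (\<lambda>x. q + x) ` X \<union> (Y + X)"
      by (auto simp: set_plus_def)
    have "(\<lambda>x. q + x) ` X \<inter> (Y + X) = {}"
    proof (rule ccontr)
      assume "\<not> ?thesis"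
      then obtain x y x' where "q + x = y + x'" "x \<in> X" "y \<in> Y" "x' \<in> X"
        by (force simp: set_plus_def)
      then have "q = y + (x' + - x)" "y + (x' + - x) \<in> Y + (X + uminus ` X)"
        by (simp, blast)
      then show False using q by simp
    qed
    then have "card (insert q Y + X) = card ((\<lambda>x. q + x) ` X) + card (Y + X)"
      unfolding eq using finY assms by (intro card_Un_disjoint) (auto intro: finite_set_plus)
    also have "\<dots> = card (insert q Y) * card X"
      using Y insert finY by (subst card_insert_disjoint) (auto simp: card_image)
    finally have "card (insert q Y + X) = card (insert q Y) * card X" .
    moreover have "q \<in> insert q Y + (X + uminus ` X)"
    proof -
      obtain x where "x \<in> X" using assms by auto
      then have "x + - x \<in> X + uminus ` X" by blast
      then show ?thesis using set_plus_intro[of q "insert q Y" 0] by simp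
    qed
    moreover have "Q \<subseteq> insert q Y + (X + uminus ` X)"
      using Y(3) set_plus_mono2[of Y "insert q Y" "X + uminus ` X" "X + uminus ` X"] by auto
    ultimately show ?thesis using Y(1) by (intro exI[of _ "insert q Y"]) auto
  qed
qed

text \<open>Chang's argument for \<open>B = -A\<close>: finitely many translates, at most
  \<open>K ^ 5\<close> of them, of \<open>W = X - X\<close> cover \<open>B + W\<close>. Iterating
  the covering puts \<open>nsum n B\<close> into \<open>nsum n Y + W\<close> up to translation, and
  the sums of a bounded set \<open>Y\<close> grow polynomially.\<close>

lemma card_nsum_polynomial:
  fixes A :: "int set" and K :: real
  assumes A: "finite A" "A \<noteq> {}" and K: "card (A + uminus ` A) \<le> K * card A"
  shows "card (nsum t A) \<le> K * (real t + 1) ^ nat \<lfloor>K ^ 5\<rfloor> * card A"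
proof -
  define B where "B = uminus ` A"
  have B: "finite B" "B \<noteq> {}" "card B = card A" "uminus ` B = A"
    using A by (auto simp: B_def card_image image_image)
  have cA: "card A > 0" using A by (auto simp: card_gt_0_iff)
  obtain X where X: "X \<subseteq> A" "X \<noteq> {}"
    and pet: "\<And>C. finite C \<Longrightarrow> real (card (X + B + C)) \<le> real (card (A + B)) / real (card A) * real (card (X + C))"
    using petridis_exists[OF A(1) B(1) A(2)] by blast
  have finX: "finite X" using X A finite_subset by auto
  have cX: "card X > 0" "card X \<le> card A" using X finX A by (auto simp: card_gt_0_iff card_mono)
  have "K * card A \<ge> 1 * card A"
    using K card_plus_mono_left[of A "uminus ` A"] A by simp
  then have K1: "K \<ge> 1" using cA by simp
  have rat: "real (card (A + B)) / real (card A) \<le> K"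
    using K cA by (simp add: B_def pos_divide_le_eq)
  have step: "real (card (X + B + C)) \<le> K * real (card (X + C))" if "finite C" for C
    using pet[OF that] mult_right_mono[OF rat, of "real (card (X + C))"] by linarith
  have pow: "real (card (X + nsum n B)) \<le> K ^ n * card X" for n
  proof (induction n)
    case (Suc n)
    have "real (card (X + nsum (Suc n) B)) \<le> K * card (X + nsum n B)"
      using step[of "nsum n B"] B by (simp add: add.assoc)
    also have "\<dots> \<le> K * (K ^ n * card X)" using Suc K1 by (intro mult_left_mono) auto
    finally show ?case by (simp add: mult.assoc)
  qed (simp flip: set_zero)
  have s2: "nsum 2 B = B + B" by (simp add: numeral_2_eq_2)
  have s3: "nsum 3 B = B + (B + B)" by (simp add: numeral_3_eq_3)
  have "real (card (B + B)) \<le> card (X + nsum 2 B)"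
    using card_plus_mono_right[of X "B + B"] X finX B by (simp add: s2 finite_set_plus)
  with pow[of 2] have BB: "real (card (B + B)) \<le> K ^ 2 * card X" by linarith
  \<comment> \<open>The triangle inequality through \<open>B\<close> replaces one copy of
    \<open>B\<close> in \<open>X + 3B\<close> by \<open>A = -B\<close>. The exponent 5 is 3 from
    \<open>X + nsum 3 B\<close> plus 2 from \<open>B + B\<close>.\<close>
  have "card B * card (X + (B + B) + uminus ` B) \<le> card (X + (B + B) + B) * card (B + B)"
    using finX B by (intro ruzsa_triangle finite_set_plus)
  also have "X + (B + B) + B = X + nsum 3 B" by (simp add: s3 ac_simps)
  finally have "real (card A) * card (X + (B + B) + A) \<le> real (card (X + nsum 3 B)) * card (B + B)"
    unfolding B of_nat_mult[symmetric] of_nat_le_iff .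
  also have "\<dots> \<le> (K ^ 3 * card X) * (K ^ 2 * card X)"
    using pow[of 3] BB K1 by (intro mult_mono) auto
  also have "\<dots> \<le> (K ^ 3 * card X) * (K ^ 2 * card A)"
    using cX K1 by (intro mult_mono) auto
  also have "\<dots> = card A * (K ^ 5 * card X)" by (simp add: eval_nat_numeral)
  finally have big: "real (card (X + (B + B) + A)) \<le> K ^ 5 * card X" using cA by simp
  define W where "W = X + uminus ` X"
  have finW: "finite W" "finite (B + W)" using finX B by (auto simp: W_def intro: finite_set_plus)
  obtain Y where Y: "Y \<subseteq> B + W" "card (Y + X) = card Y * card X" "B + W \<subseteq> Y + W"
    using ruzsa_covering[OF finW(2) finX X(2)] W_def by auto
  have finY: "finite Y" using Y finW finite_subset by auto
  \<comment> \<open>The disjoint translates of \<open>X\<close> by \<open>Y\<close> all fit into the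
    set just bounded, which limits \<open>card Y\<close>.\<close>
  have "uminus ` X \<subseteq> B" using X by (auto simp: B_def)
  then have "Y + X \<subseteq> (B + (X + B)) + A"
    using Y(1) X(1) unfolding W_def by (meson order_trans set_plus_mono2 order_refl)
  also have "\<dots> = X + (B + B) + A" by (simp add: ac_simps)
  finally have "card (Y + X) \<le> card (X + (B + B) + A)"
    using finX B A by (intro card_mono finite_set_plus)
  then have "real (card Y * card X) \<le> K ^ 5 * card X"
    using big unfolding Y(2) by (meson of_nat_mono order_trans)
  then have "real (card Y) * card X \<le> K ^ 5 * card X" by simp
  then have "real (card Y) \<le> K ^ 5" using cX by simp
  then have cY: "card Y \<le> nat \<lfloor>K ^ 5\<rfloor>" by (simp add: le_nat_floor)
  have cov: "nsum n B + W \<subseteq> nsum n Y + W" for n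
  proof (induction n)
    case (Suc n)
    have "nsum (Suc n) B + W = B + (nsum n B + W)" by (simp add: ac_simps)
    also have "\<dots> \<subseteq> B + (nsum n Y + W)" by (rule set_plus_mono2[OF order_refl Suc])
    also have "\<dots> = nsum n Y + (B + W)" by (simp add: ac_simps)
    also have "\<dots> \<subseteq> nsum n Y + (Y + W)" by (rule set_plus_mono2[OF order_refl Y(3)])
    also have "\<dots> = nsum (Suc n) Y + W" by (simp add: ac_simps)
    finally show ?case .
  qed simp
  have "W \<noteq> {}" using X by (auto simp: W_def set_plus_def)
  have "card (nsum t A) = card (nsum t B)" by (simp add: B_def card_nsum_uminus)
  also have "\<dots> \<le> card (nsum t B + W)"
    using B finW \<open>W \<noteq> {}\<close> by (intro card_plus_mono_left) auto
  also have "\<dots> \<le> card (nsum t Y + W)"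
    using cov finY finW by (intro card_mono finite_set_plus) auto
  also have "\<dots> \<le> card (nsum t Y) * card W" using finY finW by (intro card_plus_le) auto
  finally have "real (card (nsum t A)) \<le> real (card (nsum t Y)) * real (card W)"
    unfolding of_nat_mult[symmetric] of_nat_le_iff .
  also have "\<dots> \<le> (real t + 1) ^ nat \<lfloor>K ^ 5\<rfloor> * (K * card A)"
  proof (intro mult_mono)
    have "real (card (nsum t Y)) \<le> real ((t + 1) ^ card Y)"
      using card_nsum_le[OF finY] of_nat_le_iff by blast
    also have "\<dots> \<le> (real t + 1) ^ nat \<lfloor>K ^ 5\<rfloor>"
      using power_increasing[OF cY, of "real t + 1"] by (simp add: add.commute)
    finally show "real (card (nsum t Y)) \<le> (real t + 1) ^ nat \<lfloor>K ^ 5\<rfloor>" .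
    have "card W \<le> card (A + uminus ` A)"
      using X A unfolding W_def by (intro card_mono finite_set_plus set_plus_mono2) auto
    then show "real (card W) \<le> K * card A" using K by linarith
  qed auto
  finally show ?thesis by (simp add: ac_simps)
qed

section \<open>Dilates and the doubling of \<open>A\<close>\<close>

lemma card_elt_set_times:
  fixes A :: "int set"
  assumes "l \<noteq> 0"
  shows "card (l *o A) = card A"
proof -
  have "l *o A = (\<lambda>a. l * a) ` A" by (auto simp: elt_set_times_def)
  then show ?thesis using assms by (simp add: card_image inj_on_def)
qed

lemma finite_elt_set_times [simp]: "finite A \<Longrightarrow> finite ((l::int) *o A)"
  by (simp add: elt_set_times_def)

lemma elt_set_times_empty_iff [simp]: "(l::int) *o A = {} \<longleftrightarrow> A = {}"
  by (auto simp: elt_set_times_def)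

text \<open>The triangle inequality through \<open>l2 *o A\<close> bounds the difference set of
  \<open>l1 *o A\<close>, which is a dilate of \<open>A - A\<close>.\<close>

lemma card_diff_le_of_dilates:
  fixes A :: "int set" and L :: real
  assumes A: "finite A" "A \<noteq> {}" and l: "l1 \<noteq> 0" "l2 \<noteq> 0"
    and L: "card (l1 *o A + l2 *o A) \<le> L * card A"
  shows "card (A + uminus ` A) \<le> L ^ 2 * card A"
proof -
  have cA: "card A > 0" using A by (auto simp: card_gt_0_iff)
  have eq: "l1 *o A + uminus ` (l1 *o A) = l1 *o (A + uminus ` A)"
    by (fastforce simp: elt_set_times_def set_plus_def image_def algebra_simps)
  have "real (card A) * card (A + uminus ` A) \<le> real (card (l1 *o A + l2 *o A)) * card (l1 *o A + l2 *o A)"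
    using ruzsa_triangle[of "l2 *o A" "l1 *o A" "l1 *o A"] A l
    unfolding eq of_nat_mult[symmetric] of_nat_le_iff
    by (simp add: card_elt_set_times add.commute)
  also have "\<dots> \<le> (L * card A) * (L * card A)" using L by (intro mult_mono) auto
  also have "\<dots> = card A * (L ^ 2 * card A)" by (simp add: power2_eq_square)
  finally show ?thesis using cA by simp
qed

section \<open>Residue classes\<close>

text \<open>
  The modulus \<open>d = 0\<close> is allowed: then \<open>x mod 0 = x\<close>, so \<open>residue_count 0 X = card X\<close>
  and cardinality estimates are instances of residue estimates.
\<close>

definition residue_count :: "int \<Rightarrow> int set \<Rightarrow> nat" where
  "residue_count d X = card ((\<lambda>x. x mod d) ` X)"

lemma residue_count_0 [simp]: "residue_count 0 X = card X"
  by (simp add: residue_count_def)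

lemma residue_count_mono: "finite Y \<Longrightarrow> X \<subseteq> Y \<Longrightarrow> residue_count d X \<le> residue_count d Y"
  unfolding residue_count_def by (intro card_mono) auto

lemma residue_count_pos: "finite X \<Longrightarrow> X \<noteq> {} \<Longrightarrow> residue_count d X > 0"
  unfolding residue_count_def by (simp add: card_gt_0_iff)

lemma mod_eq_mod_of_dvd:
  fixes x y :: int
  assumes "x mod n = y mod n" "d dvd n"
  shows "x mod d = y mod d"
  using assms by (meson mod_eq_dvd_iff dvd_trans)

lemma residue_count_dvd_mono:
  assumes "d dvd n" "finite X"
  shows "residue_count d X \<le> residue_count n X"
proof -
  have "(\<lambda>x. x mod d) ` X = (\<lambda>x. x mod d) ` (\<lambda>x. x mod n) ` X"
    using assms(1) by (auto simp: image_image mod_mod_cancel)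
  then show ?thesis unfolding residue_count_def by (metis assms(2) card_image_le finite_imageI)
qed

text \<open>Choose representatives of \<open>T\<close> modulo \<open>d\<close> and of
  \<open>E\<close> modulo \<open>n\<close>. As \<open>E\<close> lies in one class modulo
  \<open>d\<close>, a sum modulo \<open>d\<close> determines its summand from \<open>T\<close>; then
  the sum modulo \<open>n\<close> determines the one from \<open>E\<close>.\<close>

lemma residue_count_plus_ge:
  assumes "d dvd n" "finite T" "finite E"
    and E: "\<And>x y. x \<in> E \<Longrightarrow> y \<in> E \<Longrightarrow> x mod d = y mod d"
  shows "residue_count d T * residue_count n E \<le> residue_count n (T + E)"
proof -
  define f where "f = inv_into T (\<lambda>x. x mod d)"
  define g where "g = inv_into E (\<lambda>x. x mod n)"
  have f: "f s \<in> T" "f s mod d = s" if "s \<in> (\<lambda>x. x mod d) ` T" for s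
    using inv_into_into[OF that] f_inv_into_f[OF that] by (auto simp: f_def)
  have g: "g e \<in> E" "g e mod n = e" if "e \<in> (\<lambda>x. x mod n) ` E" for e
    using inv_into_into[OF that] f_inv_into_f[OF that] by (auto simp: g_def)
  define F where "F = (\<lambda>(s, e). (f s + g e) mod n)"
  let ?P = "(\<lambda>x. x mod d) ` T \<times> (\<lambda>x. x mod n) ` E"
  have "inj_on F ?P"
  proof (rule inj_onI)
    fix p q assume p: "p \<in> ?P" and q: "q \<in> ?P" and eq: "F p = F q"
    obtain s e s' e' where pq: "p = (s, e)" "q = (s', e')" by (metis surj_pair)
    have mem: "s \<in> (\<lambda>x. x mod d) ` T" "s' \<in> (\<lambda>x. x mod d) ` T"
      "e \<in> (\<lambda>x. x mod n) ` E" "e' \<in> (\<lambda>x. x mod n) ` E" using p q pq by auto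
    have n: "(f s + g e) mod n = (f s' + g e') mod n" using eq pq by (simp add: F_def)
    then have "(f s + g e) mod d = (f s' + g e') mod d" using assms(1) mod_eq_mod_of_dvd by blast
    moreover have "g e mod d = g e' mod d" using E g mem by blast
    ultimately have "d dvd ((f s + g e) - (f s' + g e')) - (g e - g e')"
      unfolding mod_eq_dvd_iff by (rule dvd_diff)
    then have "f s mod d = f s' mod d" by (simp add: mod_eq_dvd_iff)
    then have s: "s = s'" using f mem by simp
    then have "g e mod n = g e' mod n" using n by (simp add: mod_eq_dvd_iff)
    then show "p = q" using s g mem pq by simp
  qed
  moreover have "F ` ?P \<subseteq> (\<lambda>x. x mod n) ` (T + E)"
    using f g by (auto simp: F_def intro!: imageI set_plus_intro)
  ultimately have "card ?P \<le> card ((\<lambda>x. x mod n) ` (T + E))"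
    using assms by (intro card_inj_on_le[of F]) (auto intro: finite_set_plus)
  then show ?thesis by (simp add: residue_count_def card_cartesian_product)
qed

definition fibre :: "int \<Rightarrow> int set \<Rightarrow> int \<Rightarrow> int set" where
  "fibre d A r = {a \<in> A. a mod d = r}"

lemma fibre_subset: "fibre d A r \<subseteq> A"
  by (auto simp: fibre_def)

lemma finite_fibre [simp]: "finite A \<Longrightarrow> finite (fibre d A r)"
  by (simp add: fibre_def)

lemma fibre_mod: "x \<in> fibre d A r \<Longrightarrow> x mod d = r"
  by (simp add: fibre_def)

lemma residue_count_fibre_sum:
  assumes "finite A" "d dvd n"
  shows "residue_count n A = (\<Sum>r\<in>(\<lambda>x. x mod d) ` A. residue_count n (fibre d A r))"
proof -
  have "(\<Sum>x\<in>(\<lambda>x. x mod n) ` A. 1) =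
      (\<Sum>r\<in>(\<lambda>x. x mod d) ` (\<lambda>x. x mod n) ` A. \<Sum>x\<in>{x \<in> (\<lambda>x. x mod n) ` A. x mod d = r}. 1 :: nat)"
    using assms by (intro sum.image_gen) auto
  also have "(\<lambda>x. x mod d) ` (\<lambda>x. x mod n) ` A = (\<lambda>x. x mod d) ` A"
    using assms(2) by (auto simp: image_image mod_mod_cancel)
  also have "(\<Sum>r\<in>(\<lambda>x. x mod d) ` A. \<Sum>x\<in>{x \<in> (\<lambda>x. x mod n) ` A. x mod d = r}. 1 :: nat) =
      (\<Sum>r\<in>(\<lambda>x. x mod d) ` A. residue_count n (fibre d A r))"
  proof (intro sum.cong refl)
    fix r
    have "{x \<in> (\<lambda>x. x mod n) ` A. x mod d = r} = (\<lambda>x. x mod n) ` fibre d A r"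
      using assms(2) by (auto simp: fibre_def mod_mod_cancel)
    then show "(\<Sum>x\<in>{x \<in> (\<lambda>x. x mod n) ` A. x mod d = r}. 1) = residue_count n (fibre d A r)"
      by (simp add: residue_count_def)
  qed
  finally show ?thesis by (simp add: residue_count_def)
qed

lemma card_fibre_sum:
  "finite A \<Longrightarrow> card A = (\<Sum>r\<in>(\<lambda>x. x mod d) ` A. card (fibre d A r))"
  using residue_count_fibre_sum[of A d 0, OF _ dvd_0_right] unfolding residue_count_0 .

lemma exists_large_fibre:
  assumes "finite A" "A \<noteq> {}" "d dvd n"
  obtains r where "r \<in> (\<lambda>x. x mod d) ` A" "residue_count n A \<le> residue_count d A * residue_count n (fibre d A r)"
proof -
  let ?R = "(\<lambda>x. x mod d) ` A"
  let ?f = "\<lambda>s. residue_count n (fibre d A s)"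
  have "Max (?f ` ?R) \<in> ?f ` ?R" using assms by (intro Max_in) auto
  then obtain r where "Max (?f ` ?R) = ?f r" "r \<in> ?R" by (rule imageE)
  then have r: "r \<in> ?R" "\<And>s. s \<in> ?R \<Longrightarrow> ?f s \<le> ?f r"
    using assms by (auto simp del: Max_le_iff simp flip: \<open>Max (?f ` ?R) = ?f r\<close>)
  have "residue_count n A \<le> card ?R * residue_count n (fibre d A r)"
    unfolding residue_count_fibre_sum[OF assms(1,3)] using sum_bounded_above[OF r(2)] by fastforce
  then show thesis using that r by (simp add: residue_count_def)
qed

lemma residue_count_mult_card_fibre_le:
  assumes "finite T" "finite A"
  shows "residue_count d T * card (fibre d A r) \<le> card (T + A)"
proof -
  have "residue_count d T * card (fibre d A r) \<le> card (T + fibre d A r)"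
    using residue_count_plus_ge[of d 0 T "fibre d A r"] assms by (simp add: fibre_mod)
  also have "\<dots> \<le> card (T + A)"
    using assms by (intro card_mono finite_set_plus set_plus_mono2) (auto simp: fibre_subset)
  finally show ?thesis .
qed

text \<open>Converts residues of \<open>T\<close> into elements of \<open>T + A\<close>: a largest
  class of \<open>A\<close> has at least the average size, and its translates by elements of
  \<open>T\<close> in different classes are disjoint.\<close>

lemma residue_count_mult_card_le:
  assumes "finite T" "finite A" "A \<noteq> {}"
  shows "residue_count d T * card A \<le> residue_count d A * card (T + A)"
proof -
  obtain r where r: "card A \<le> residue_count d A * card (fibre d A r)"
    using exists_large_fibre[of A d 0] assms by auto
  have "residue_count d T * card A \<le> residue_count d T * (residue_count d A * card (fibre d A r))" using r by simp
  also have "\<dots> \<le> residue_count d A * card (T + A)"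
    using residue_count_mult_card_fibre_le[OF assms(1,2), of d r] mult_le_mono2[of "residue_count d T * card (fibre d A r)"]
    by (simp add: ac_simps)
  finally show ?thesis .
qed

section \<open>Moduli fixed by passing to the gcd of differences\<close>

text \<open>Bezout's identity for arbitrary, possibly infinite, \<open>D\<close>. Division with
  remainder by the least positive element of \<open>H\<close> shows that it divides all of
  \<open>D\<close>, hence also \<open>Gcd D\<close>.\<close>

lemma subgroup_Gcd_mem:
  fixes H D :: "int set"
  assumes H: "0 \<in> H" "\<And>x y. x \<in> H \<Longrightarrow> y \<in> H \<Longrightarrow> x + y \<in> H" "\<And>x. x \<in> H \<Longrightarrow> - x \<in> H"
    and D: "D \<subseteq> H"
  shows "Gcd D * j \<in> H"
proof -
  have nat_mult: "x * int k \<in> H" if "x \<in> H" for x k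
    using H that by (induction k) (auto simp: algebra_simps)
  have mult: "x * k \<in> H" if "x \<in> H" for x k
  proof (cases "k \<ge> 0")
    case True
    then show ?thesis using nat_mult[OF that, of "nat k"] by simp
  next
    case False
    then show ?thesis using H(3)[OF nat_mult[OF that, of "nat (- k)"]] by simp
  qed
  show ?thesis
  proof (cases "D \<subseteq> {0}")
    case True
    then have "Gcd D = 0" by (simp add: Gcd_0_iff)
    then show ?thesis using H(1) by (metis mult_zero_left)
  next
    case False
    then obtain x where x: "x \<in> H" "x \<noteq> 0" using D by auto
    define g where "g = (LEAST n. n > 0 \<and> int n \<in> H)"
    have "nat \<bar>x\<bar> > 0 \<and> int (nat \<bar>x\<bar>) \<in> H" using x H(3)[of x] by (auto simp: abs_if)
    then have g: "g > 0" "int g \<in> H" unfolding g_def by (metis (mono_tags, lifting) LeastI)+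
    have "int g dvd y" if "y \<in> D" for y
    proof (rule ccontr)
      assume "\<not> int g dvd y"
      then have "y mod int g \<noteq> 0" by (simp add: dvd_eq_mod_eq_0)
      moreover have "y mod int g \<ge> 0" using g by simp
      ultimately have pos: "y mod int g > 0" by linarith
      have "y + - (int g * (y div int g)) \<in> H"
        using H(2)[OF subsetD[OF D that] H(3)[OF mult[OF g(2)]]] .
      then have "y mod int g \<in> H" by (simp add: minus_mult_div_eq_mod)
      then have "g \<le> nat (y mod int g)" unfolding g_def by (intro Least_le conjI) (use pos in \<open>auto simp flip: g_def\<close>)
      moreover have "y mod int g < int g" using g by simp
      ultimately show False using pos by linarith
    qed
    then have "int g dvd Gcd D" by (rule Gcd_greatest)
    then obtain k where "Gcd D = int g * k" by auto
    then show ?thesis using mult[OF g(2), of "k * j"] by (simp add: mult.assoc)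
  qed
qed

text \<open>\<open>Gcd (differences e A)\<close> is the greatest modulus, with respect to
  divisibility, that splits \<open>A\<close> into the same classes as \<open>e\<close> does.\<close>

definition differences :: "int \<Rightarrow> int set \<Rightarrow> int set" where
  "differences e A = {a - b |a b. a \<in> A \<and> b \<in> A \<and> e dvd a - b}"

text \<open>If no pair \<open>a, b\<close> of congruent elements enlarges \<open>F\<close> modulo
  \<open>n\<close>, every difference \<open>a - b\<close> is a period of \<open>F\<close> modulo
  \<open>n\<close>. The periods form a group, so the gcd \<open>d\<close> is a period too, and its
  multiples give \<open>M\<close> residues.\<close>

lemma residue_count_ge_of_stable:
  fixes d n :: int and M :: nat
  assumes d: "d > 0" and M: "M > 0" and n: "n = d * int M"
    and F: "finite F" "F \<noteq> {}"
    and Gcd: "Gcd (differences d A) = d"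
    and st: "\<And>a b. a \<in> A \<Longrightarrow> b \<in> A \<Longrightarrow> d dvd a - b \<Longrightarrow> residue_count n (F + {a, b}) \<le> residue_count n F"
  shows "M \<le> residue_count n F"
proof -
  let ?R = "(\<lambda>x. x mod n) ` F"
  define H where "H = {h. \<forall>f\<in>F. (f + h) mod n \<in> ?R \<and> (f + - h) mod n \<in> ?R}"
  have shift: "(f + (a - b)) mod n \<in> ?R" if ab: "a \<in> A" "b \<in> A" "d dvd a - b" and f: "f \<in> F" for a b f
  proof -
    have c: "card ((\<lambda>x. x mod n) ` (\<lambda>f. f + c) ` F) = residue_count n F" for c
    proof -
      have "x mod n = y mod n" if "(x mod n + c) mod n = (y mod n + c) mod n" for x y
        using that unfolding mod_add_left_eq by (simp add: mod_eq_dvd_iff)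
      then have "inj_on (\<lambda>x. (x + c) mod n) ?R" by (blast intro: inj_onI)
      then have "card ((\<lambda>x. (x + c) mod n) ` ?R) = card ?R" by (rule card_image)
      moreover have "(\<lambda>x. (x + c) mod n) ` ?R = (\<lambda>x. x mod n) ` (\<lambda>f. f + c) ` F"
        by (simp add: image_image mod_add_left_eq)
      ultimately show ?thesis by (simp add: residue_count_def)
    qed
    \<comment> \<open>Both translates \<open>F + a\<close> and \<open>F + b\<close> lie in
      \<open>F + {a, b}\<close> and have as many residues as \<open>F\<close>, so by stability each
      of them fills it.\<close>
    have im: "(\<lambda>x. x mod n) ` (\<lambda>f. f + c) ` F = (\<lambda>x. x mod n) ` (F + {a, b})" if "c \<in> {a, b}" for c
    proof (rule card_seteq)
      show "finite ((\<lambda>x. x mod n) ` (F + {a, b}))" using F by (simp add: finite_set_plus)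
      show "(\<lambda>x. x mod n) ` (\<lambda>f. f + c) ` F \<subseteq> (\<lambda>x. x mod n) ` (F + {a, b})"
        using that by (intro image_mono) (auto simp: set_plus_def)
      show "card ((\<lambda>x. x mod n) ` (F + {a, b})) \<le> card ((\<lambda>x. x mod n) ` (\<lambda>f. f + c) ` F)"
        using st[OF ab] unfolding c by (simp only: residue_count_def)
    qed
    have eq: "(\<lambda>x. x mod n) ` (\<lambda>f. f + a) ` F = (\<lambda>x. x mod n) ` (\<lambda>f. f + b) ` F"
      using im[OF insertI1] im[OF insertI2[OF singletonI]] by (rule trans[OF _ sym])
    have "(f + a) mod n \<in> (\<lambda>x. x mod n) ` (\<lambda>f. f + a) ` F" using f by blast
    then obtain f' where f': "f' \<in> F" "(f + a) mod n = (f' + b) mod n" unfolding eq by auto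
    then have "(f + (a - b)) mod n = f' mod n" by (simp add: mod_eq_dvd_iff algebra_simps)
    then show ?thesis using f' by simp
  qed
  have closed: "(f + (h + h')) mod n \<in> ?R"
    if h: "\<forall>f\<in>F. (f + h) mod n \<in> ?R" and h': "\<forall>f\<in>F. (f + h') mod n \<in> ?R" and f: "f \<in> F" for f h h'
  proof -
    obtain f' where f': "f' \<in> F" "(f + h) mod n = f' mod n" using h f by auto
    then have "(f + (h + h')) mod n = (f' + h') mod n" by (simp add: mod_eq_dvd_iff algebra_simps)
    then show ?thesis using h' f' by simp
  qed
  have "Gcd (differences d A) * int j \<in> H" for j
  proof (rule subgroup_Gcd_mem)
    show "0 \<in> H" by (simp add: H_def)
    show "x + y \<in> H" if "x \<in> H" "y \<in> H" for x y
      using that closed[of x y] closed[of "- x" "- y"] unfolding H_def by (auto simp: algebra_simps)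
    show "- x \<in> H" if "x \<in> H" for x using that unfolding H_def by auto
    show "differences d A \<subseteq> H"
    proof
      fix h assume "h \<in> differences d A"
      then obtain a b where ab: "h = a - b" "a \<in> A" "b \<in> A" "d dvd a - b"
        unfolding differences_def by blast
      then have "(f + h) mod n \<in> ?R" "(f + - h) mod n \<in> ?R" if "f \<in> F" for f
        using shift[of a b f] shift[of b a f] that by (simp_all only: dvd_diff_commute minus_diff_eq)
      then show "h \<in> H" unfolding H_def by blast
    qed
  qed
  then have H: "d * int j \<in> H" for j using Gcd by simp
  obtain f where f: "f \<in> F" using F by auto
  have "inj_on (\<lambda>j. (f + d * int j) mod n) {..<M}"
  proof (rule inj_onI)
    fix i j assume ij: "i \<in> {..<M}" "j \<in> {..<M}" "(f + d * int i) mod n = (f + d * int j) mod n"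
    then have "d * int M dvd d * (int i - int j)"
      unfolding mod_eq_dvd_iff n by (simp add: algebra_simps)
    then have "int M dvd int i - int j" using d by simp
    then have "int i mod int M = int j mod int M" by (simp add: mod_eq_dvd_iff)
    then show "i = j" using ij by (simp add: mod_pos_pos_trivial)
  qed
  then have "card ((\<lambda>j. (f + d * int j) mod n) ` {..<M}) = M" by (simp add: card_image)
  moreover have "(\<lambda>j. (f + d * int j) mod n) ` {..<M} \<subseteq> ?R" using H f by (auto simp: H_def)
  ultimately show ?thesis unfolding residue_count_def by (metis F(1) card_mono finite_imageI)
qed

text \<open>
  The moduli of interest are the fixed points \<open>d = Gcd (differences d A)\<close>: no further prime can be
  adjoined to \<open>d\<close> without splitting some class of \<open>A\<close>, so a bounded sum of copies of \<open>A\<close>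
  already fills all \<open>M\<close> subclasses of one class.
\<close>

lemma exists_spread_subset:
  fixes d n :: int and M :: nat
  assumes d: "d > 0" and M: "M > 0" and n: "n = d * int M"
    and A: "finite A" "A \<noteq> {}" and Gcd: "Gcd (differences d A) = d"
  shows "\<exists>E\<subseteq>nsum j A. E \<noteq> {} \<and> (\<forall>x\<in>E. \<forall>y\<in>E. x mod d = y mod d) \<and> min (Suc j) M \<le> residue_count n E"
proof (induction j)
  case 0
  then show ?case by (intro exI[of _ "{0}"]) (simp add: residue_count_def)
next
  case (Suc j)
  then obtain E where E: "E \<subseteq> nsum j A" "E \<noteq> {}" "\<And>x y. x \<in> E \<Longrightarrow> y \<in> E \<Longrightarrow> x mod d = y mod d"
    "min (Suc j) M \<le> residue_count n E" by blast
  have finE: "finite E" using E A finite_subset by (metis finite_nsum)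
  \<comment> \<open>Once \<open>M\<close> residues are reached, a mere translation
    (\<open>a = b\<close>) keeps them. Before that, \<open>E\<close> cannot be stable, and some
    congruent pair produces a new residue.\<close>
  obtain a b where ab: "a \<in> A" "b \<in> A" "d dvd a - b" "min (Suc (Suc j)) M \<le> residue_count n (E + {a, b})"
  proof (cases "M \<le> residue_count n E")
    case True
    obtain a where "a \<in> A" using A by auto
    moreover have "residue_count n {a} * residue_count n E \<le> residue_count n (E + {a, a})"
      using residue_count_plus_ge[of n n E "{a}"] finE by (simp add: mult.commute)
    ultimately show thesis using True by (intro that[of a a]) (auto simp: residue_count_def)
  next
    case False
    then obtain a b where "a \<in> A" "b \<in> A" "d dvd a - b" "residue_count n (E + {a, b}) > residue_count n E"
      using residue_count_ge_of_stable[OF d M n finE E(2) Gcd] by (meson not_le)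
    then show thesis using E(4) False by (intro that[of a b]) auto
  qed
  have "x mod d = y mod d" if xy: "x \<in> E + {a, b}" "y \<in> E + {a, b}" for x y
  proof -
    obtain e e' s s' where e: "x = e + s" "y = e' + s'" "e \<in> E" "e' \<in> E" "s \<in> {a, b}" "s' \<in> {a, b}"
      using xy by (auto elim!: set_plus_elim)
    have "d dvd e - e'" using E(3) e mod_eq_dvd_iff by blast
    moreover have "d dvd s - s'" using e ab by (auto simp: dvd_diff_commute)
    ultimately have "d dvd (e - e') + (s - s')" by (rule dvd_add)
    then show ?thesis using e by (simp add: mod_eq_dvd_iff algebra_simps)
  qed
  moreover have "E + {a, b} \<subseteq> nsum j A + A" using E ab by (intro set_plus_mono2) auto
  then have "E + {a, b} \<subseteq> nsum (Suc j) A" by (simp add: add.commute)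
  moreover have "E + {a, b} \<noteq> {}" using E by (auto simp: set_plus_def)
  ultimately show ?case using ab(4) by blast
qed

text \<open>Adding \<open>M\<close> further copies of \<open>A\<close> supplies a set inside one
  class modulo \<open>d\<close> with \<open>M\<close> residues modulo \<open>d * M\<close>, which
  refines each class of \<open>nsum t A\<close> into \<open>M\<close> subclasses.\<close>

lemma residue_count_nsum_growth:
  fixes d :: int and M :: nat
  assumes d: "d > 0" and M: "M > 0"
    and A: "finite A" "A \<noteq> {}" and Gcd: "Gcd (differences d A) = d"
  shows "M * residue_count d (nsum t A) \<le> residue_count (d * int M) (nsum (t + M) A)"
proof -
  obtain E where E: "E \<subseteq> nsum M A" "\<forall>x\<in>E. \<forall>y\<in>E. x mod d = y mod d"
    "min (Suc M) M \<le> residue_count (d * int M) E"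
    using exists_spread_subset[OF d M refl A Gcd] by blast
  then have M: "M \<le> residue_count (d * int M) E" by simp
  have "finite E" using E A finite_subset by (metis finite_nsum)
  have "M * residue_count d (nsum t A) \<le> residue_count d (nsum t A) * residue_count (d * int M) E" using M by simp
  also have "\<dots> \<le> residue_count (d * int M) (nsum t A + E)"
  proof (rule residue_count_plus_ge)
    show "x mod d = y mod d" if "x \<in> E" "y \<in> E" for x y using E(2) that by blast
  qed (use A \<open>finite E\<close> in auto)
  also have "\<dots> \<le> residue_count (d * int M) (nsum (t + M) A)"
    unfolding nsum_add using A by (intro residue_count_mono finite_set_plus set_plus_mono2[OF order_refl E(1)]) simp_all
  finally show ?thesis .
qed

text \<open>The gcd of the differences divisible by \<open>e\<close> splits \<open>A\<close> exactly
  as \<open>e\<close> does, so taking the gcd again changes nothing. Two distinct elements of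
  \<open>A\<close> in a common class ensure that it is not 0.\<close>

lemma exists_reduced_modulus:
  fixes e :: int
  assumes e: "e > 0" and A: "finite A" and c: "residue_count e A < card A"
  shows "\<exists>d>0. e dvd d \<and> Gcd (differences d A) = d \<and> residue_count d A = residue_count e A"
proof -
  define d where "d = Gcd (differences e A)"
  have "\<not> inj_on (\<lambda>x. x mod e) A"
    using c card_image[of "\<lambda>x. x mod e" A] unfolding residue_count_def by linarith
  then obtain a b where ab: "a \<in> A" "b \<in> A" "a \<noteq> b" "e dvd a - b"
    by (auto simp: inj_on_def mod_eq_dvd_iff)
  then have "a - b \<in> differences e A" by (auto simp: differences_def)
  then have "d dvd a - b" unfolding d_def by (rule Gcd_dvd)
  then have "d \<noteq> 0" using ab by auto
  then have d: "d > 0" unfolding d_def using Gcd_int_greater_eq_0 by (metis order_le_less)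
  have ed: "e dvd d" unfolding d_def by (rule Gcd_greatest) (auto simp: differences_def)
  have iff: "d dvd a - b \<longleftrightarrow> e dvd a - b" if "a \<in> A" "b \<in> A" for a b
    using that ed dvd_trans unfolding d_def by (auto simp: differences_def intro!: Gcd_dvd)
  then have "differences d A = differences e A" unfolding differences_def by blast
  moreover have "residue_count d A = residue_count e A"
  proof -
    have "(\<lambda>x. x mod e) ` A = (\<lambda>x. x mod e) ` (\<lambda>x. x mod d) ` A"
      using ed by (auto simp: image_image mod_mod_cancel)
    moreover have "inj_on (\<lambda>x. x mod e) ((\<lambda>x. x mod d) ` A)"
    proof (rule inj_onI)
      fix u v assume "u \<in> (\<lambda>x. x mod d) ` A" "v \<in> (\<lambda>x. x mod d) ` A" "u mod e = v mod e"
      then obtain x y where xy: "u = x mod d" "v = y mod d" "x \<in> A" "y \<in> A" "x mod e = y mod e"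
        using ed by (auto simp: mod_mod_cancel)
      then show "u = v" using iff by (simp add: mod_eq_dvd_iff)
    qed
    ultimately show ?thesis unfolding residue_count_def by (simp add: card_image)
  qed
  ultimately show ?thesis using d ed d_def by (intro exI[of _ d]) auto
qed

section \<open>Moduli in which most classes are saturated\<close>

text \<open>
  Along a chain of moduli \<open>d\<^sub>0, d\<^sub>1, \<dots>\<close>, where \<open>d\<^sub>j\<^sub>+\<^sub>1\<close> is the fixed point above \<open>d\<^sub>j * M\<close>, the class count of
  \<open>j * M\<close>-fold sums grows like \<open>M ^ j\<close>; if no step is nearly maximal for \<open>A\<close> itself, the
  class count of \<open>A\<close> grows only like \<open>(q * M) ^ j\<close>, which polynomial growth forbids.
\<close>

lemma exists_dense_modulus_or_chain:
  fixes A :: "int set" and M J :: nat and q :: real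
  assumes A: "finite A" "A \<noteq> {}" and M: "M > 0" and q: "0 \<le> q" "q \<le> 1"
    and big: "M ^ J < card A" and "j \<le> J"
  shows "(\<exists>d>0. residue_count d A \<le> M ^ J \<and> q * M * residue_count d A < residue_count (d * int M) A) \<or>
    (\<exists>d>0. Gcd (differences d A) = d \<and> residue_count d A \<le> (q * M) ^ j \<and> M ^ j \<le> residue_count d (nsum (j * M) A))"
  using \<open>j \<le> J\<close>
proof (induction j)
  case 0
  have n1: "residue_count 1 X = 1" if "X \<noteq> {}" for X using that by (simp add: residue_count_def image_constant_conv)
  have "M ^ J \<ge> 1" using M by simp
  then have "residue_count 1 A < card A" using n1[OF A(2)] big by linarith
  then obtain d where d: "d > 0" "Gcd (differences d A) = d" "residue_count d A = residue_count 1 A"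
    using exists_reduced_modulus[of 1 A] A by auto
  moreover have "residue_count d {0} = 1" by (simp add: residue_count_def)
  ultimately show ?case using n1[OF A(2)] by (intro disjI2 exI[of _ d]) simp
next
  case (Suc j)
  then consider "\<exists>d>0. residue_count d A \<le> M ^ J \<and> q * M * residue_count d A < residue_count (d * int M) A"
    | d where "d > 0" "Gcd (differences d A) = d" "residue_count d A \<le> (q * M) ^ j" "M ^ j \<le> residue_count d (nsum (j * M) A)"
    by (meson Suc_leD)
  then show ?case
  proof cases
    case (2 d)
    have qM: "(q * M) ^ i \<le> real (M ^ i)" for i
      using q by (simp add: power_mult_distrib mult_left_le_one_le power_le_one)
    have MJ: "M ^ i \<le> M ^ J" if "i \<le> J" for i using M that by (simp add: power_increasing)
    have "residue_count d A \<le> M ^ j" using 2(3) qM[of j] by linarith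
    then have cJ: "residue_count d A \<le> M ^ J" using MJ[of j] Suc by linarith
    show ?thesis
    proof (cases "q * M * residue_count d A < residue_count (d * int M) A")
      case True
      then show ?thesis using 2 cJ by blast
    next
      case False
      then have "residue_count (d * int M) A \<le> q * M * residue_count d A" by simp
      also have "\<dots> \<le> q * M * (q * M) ^ j" using 2 q by (intro mult_left_mono) auto
      finally have c: "residue_count (d * int M) A \<le> (q * M) ^ Suc j" by simp
      then have "residue_count (d * int M) A \<le> M ^ Suc j" using qM[of "Suc j"] by linarith
      \<comment> \<open>The bound \<open>M ^ J < card A\<close> leaves two elements in a common
        class, as reducing the modulus requires.\<close>
      then have "residue_count (d * int M) A < card A" using MJ[of "Suc j"] Suc big by linarith
      then obtain d' where d': "d' > 0" "d * int M dvd d'" "Gcd (differences d' A) = d'"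
        "residue_count d' A = residue_count (d * int M) A"
        using exists_reduced_modulus[of "d * int M" A] A 2 M by auto
      have "M ^ Suc j \<le> M * residue_count d (nsum (j * M) A)" using 2 by simp
      also have "\<dots> \<le> residue_count (d * int M) (nsum (j * M + M) A)"
        using residue_count_nsum_growth[OF 2(1) M A 2(2)] .
      also have "\<dots> \<le> residue_count d' (nsum (j * M + M) A)" using d' A by (intro residue_count_dvd_mono) auto
      finally have "M ^ Suc j \<le> residue_count d' (nsum (Suc j * M) A)" by (simp add: add.commute)
      then show ?thesis using d' c by auto
    qed
  qed blast
qed

text \<open>A chain of full length \<open>J\<close> would force \<open>M ^ J * card A\<close> to be
  at most \<open>(q * M) ^ J\<close> times the size of the sum of \<open>J * M + 1\<close> copies of
  \<open>A\<close>. Polynomial growth and the choice of \<open>J\<close> exclude this.\<close>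

lemma exists_dense_modulus:
  fixes A :: "int set" and M J r :: nat and q K :: real
  assumes A: "finite A" "A \<noteq> {}" and M: "M > 0" and q: "0 \<le> q" "q \<le> 1"
    and big: "M ^ J < card A"
    and growth: "\<And>t. card (nsum t A) \<le> K * (real t + 1) ^ r * card A"
    and J: "q ^ J * (K * (real (J * M) + 2) ^ r) < 1"
  shows "\<exists>d>0. residue_count d A \<le> M ^ J \<and> q * M * residue_count d A < residue_count (d * int M) A"
proof (rule ccontr)
  assume "\<not> ?thesis"
  then obtain d where d: "d > 0" "residue_count d A \<le> (q * M) ^ J" "M ^ J \<le> residue_count d (nsum (J * M) A)"
    using exists_dense_modulus_or_chain[OF A M q big order_refl] by blast
  have cA: "card A > 0" using A by (simp add: card_gt_0_iff)
  have "M ^ J * card A \<le> residue_count d (nsum (J * M) A) * card A" using d by simp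
  also have "\<dots> \<le> residue_count d A * card (nsum (Suc (J * M)) A)"
    using residue_count_mult_card_le[of "nsum (J * M) A" A d] A by (simp add: add.commute)
  finally have "real (M ^ J * card A) \<le> real (residue_count d A) * card (nsum (Suc (J * M)) A)"
    unfolding of_nat_mult[symmetric] of_nat_le_iff .
  also have "\<dots> \<le> (q * M) ^ J * (K * (real (Suc (J * M)) + 1) ^ r * card A)"
    using q by (intro mult_mono d(2) growth) auto
  also have "\<dots> = (q ^ J * (K * (real (J * M) + 2) ^ r)) * (M ^ J * card A)"
    by (simp add: power_mult_distrib ac_simps)
  also have "\<dots> < 1 * real (M ^ J * card A)" using J cA M by (intro mult_strict_right_mono) auto
  finally show False by simp
qed

text \<open>Exponential decay beats the polynomial factor; \<open>J * M + 2\<close> is first bounded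
  by \<open>(M + 1) * (J + 2)\<close> to separate \<open>M\<close> from \<open>J\<close>.\<close>

lemma exists_chain_length:
  fixes q K :: real and M r :: nat
  assumes "0 < q" "q < 1"
  obtains J where "q ^ J * (K * (real (J * M) + 2) ^ r) < 1"
proof -
  define m where "m = real M"
  have "m \<ge> 0" by (simp add: m_def)
  have "(\<lambda>J::nat. q ^ J * (real J + 2) ^ r) \<longlonglongrightarrow> 0"
    using assms by real_asymp
  then have "(\<lambda>J::nat. (\<bar>K\<bar> * (m + 1) ^ r) * (q ^ J * (real J + 2) ^ r)) \<longlonglongrightarrow> 0"
    using tendsto_mult_right_zero by blast
  then have "eventually (\<lambda>J::nat. (\<bar>K\<bar> * (m + 1) ^ r) * (q ^ J * (real J + 2) ^ r) < 1) sequentially"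
    by (rule order_tendstoD) simp
  then obtain J :: nat where J: "(\<bar>K\<bar> * (m + 1) ^ r) * (q ^ J * (real J + 2) ^ r) < 1"
    using eventually_happens by fastforce
  have "real (J * M) + 2 \<le> (m + 1) * (real J + 2)"
    using \<open>m \<ge> 0\<close> by (simp add: m_def algebra_simps)
  then have "(real (J * M) + 2) ^ r \<le> (m + 1) ^ r * (real J + 2) ^ r"
    unfolding power_mult_distrib[symmetric] by (intro power_mono) auto
  then have "q ^ J * (K * (real (J * M) + 2) ^ r) \<le> q ^ J * (\<bar>K\<bar> * ((m + 1) ^ r * (real J + 2) ^ r))"
    using assms by (intro mult_left_mono mult_mono) auto
  also have "\<dots> < 1" using J by (simp add: ac_simps)
  finally show thesis using that by blast
qed

section \<open>Passing to a saturated subset\<close>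

text \<open>The residues modulo \<open>d * M\<close> lying above \<open>r\<close> are among the
  \<open>M\<close> numbers \<open>r + d * j\<close>; a class with \<open>M\<close> residues must
  attain all of them.\<close>

lemma
  fixes d :: int and M :: nat
  assumes "d > 0" "finite A" "M > 0"
  shows residue_count_fibre_le: "residue_count (d * int M) (fibre d A r) \<le> M"
    and fibre_full: "residue_count (d * int M) (fibre d A r) = M \<Longrightarrow> x mod d = r \<Longrightarrow>
      \<exists>a\<in>fibre d A r. a mod (d * int M) = x mod (d * int M)"
proof -
  define P where "P = (\<lambda>j. r + d * int j) ` {..<M}"
  have mem: "y mod (d * int M) \<in> P" if "y mod d = r" for y
  proof -
    have "y mod (d * int M) = d * (y div d mod int M) + y mod d"
      using assms by (intro zmod_zmult2_eq) simp
    then have "y mod (d * int M) = r + d * int (nat (y div d mod int M))" using that assms by simp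
    moreover have "nat (y div d mod int M) < M" using assms by (simp add: nat_less_iff)
    ultimately show ?thesis unfolding P_def by blast
  qed
  have sub: "(\<lambda>x. x mod (d * int M)) ` fibre d A r \<subseteq> P"
    using mem by (auto simp: fibre_def)
  have cP: "card P \<le> M" unfolding P_def using card_image_le[of "{..<M}"] by simp
  have finP: "finite P" by (simp add: P_def)
  show "residue_count (d * int M) (fibre d A r) \<le> M"
    unfolding residue_count_def using card_mono[OF finP sub] cP by simp
  show "\<exists>a\<in>fibre d A r. a mod (d * int M) = x mod (d * int M)"
    if "residue_count (d * int M) (fibre d A r) = M" "x mod d = r"
  proof -
    have "(\<lambda>x. x mod (d * int M)) ` fibre d A r = P"
      using that(1) cP unfolding residue_count_def by (intro card_seteq finP sub) simp
    then have "x mod (d * int M) \<in> (\<lambda>x. x mod (d * int M)) ` fibre d A r"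
      using mem[of x] that by simp
    then obtain a where "x mod (d * int M) = a mod (d * int M)" "a \<in> fibre d A r" by (rule imageE)
    then show ?thesis by (intro bexI[of _ a]) (rule sym)
  qed
qed

text \<open>The formal version of saturation, with subclasses taken modulo
  \<open>d * M\<close>.\<close>

definition full :: "int \<Rightarrow> nat \<Rightarrow> int set \<Rightarrow> bool" where
  "full d M A \<longleftrightarrow> (\<forall>x. x mod d \<in> (\<lambda>a. a mod d) ` A \<longrightarrow> x mod (d * int M) \<in> (\<lambda>a. a mod (d * int M)) ` A)"

text \<open>Keep exactly the saturated classes. Density makes the others at most a proportion
  \<open>(1 - q) * M\<close> of all classes, and none of these exceeds \<open>K\<close> times the
  average size.\<close>

lemma exists_full_subset:
  fixes A :: "int set" and M :: nat and d :: int and q K :: real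
  assumes A: "finite A" "A \<noteq> {}" and M: "M > 0" and d: "d > 0" and q: "0 \<le> q" "q \<le> 1"
    and dense: "q * M * residue_count d A \<le> residue_count (d * int M) A"
    and K: "card (A + A) \<le> K * card A"
  shows "\<exists>A'\<subseteq>A. full d M A' \<and> residue_count d A' \<le> residue_count d A \<and> (1 - (1 - q) * M * K) * card A \<le> card A'"
proof -
  let ?R = "(\<lambda>x. x mod d) ` A"
  let ?ch = "\<lambda>r. residue_count (d * int M) (fibre d A r)"
  define R where "R = {r \<in> ?R. ?ch r = M}"
  define A' where "A' = {a \<in> A. a mod d \<in> R}"
  have finR: "finite ?R" using A by simp
  have cA: "card A > 0" using A by (simp add: card_gt_0_iff)
  have cl: "residue_count d A > 0" using A by (rule residue_count_pos)
  have K0: "K \<ge> 0"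
  proof -
    have "0 \<le> K * card A" using K by (meson of_nat_0_le_iff order_trans)
    then show ?thesis using cA by (simp add: zero_le_mult_iff)
  qed
  have sub: "A' \<subseteq> A" by (auto simp: A'_def)
  have full: "full d M A'"
    unfolding full_def
  proof (intro allI impI)
    fix x assume "x mod d \<in> (\<lambda>a. a mod d) ` A'"
    then have "x mod d \<in> R" by (auto simp: A'_def)
    then obtain a where "a \<in> fibre d A (x mod d)" "a mod (d * int M) = x mod (d * int M)"
      using fibre_full[OF d A(1) M, of "x mod d" x] by (auto simp: R_def)
    then show "x mod (d * int M) \<in> (\<lambda>a. a mod (d * int M)) ` A'"
      using \<open>x mod d \<in> R\<close> by (auto simp: fibre_def A'_def intro!: rev_image_eqI)
  qed
  have "residue_count (d * int M) A = (\<Sum>r\<in>?R. ?ch r)" using A by (intro residue_count_fibre_sum) auto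
  \<comment> \<open>An unsaturated class misses at least one of its \<open>M\<close>
    subclasses.\<close>
  also have "\<dots> \<le> (\<Sum>r\<in>?R. M - (if r \<in> ?R - R then 1 else 0))"
  proof (intro sum_mono)
    fix r assume "r \<in> ?R"
    then show "?ch r \<le> M - (if r \<in> ?R - R then 1 else 0)"
      using residue_count_fibre_le[OF d A(1) M, of r] by (auto simp: R_def)
  qed
  finally have "real (residue_count (d * int M) A) \<le> real (\<Sum>r\<in>?R. M - (if r \<in> ?R - R then 1 else 0))"
    using of_nat_mono by blast
  also have "\<dots> = (\<Sum>r\<in>?R. real M - (if r \<in> ?R - R then 1 else 0))"
    unfolding of_nat_sum using M by (intro sum.cong) auto
  also have "\<dots> = real M * residue_count d A - card (?R - R)"
  proof -
    have "?R \<inter> {r. r \<notin> R} = ?R - R" by auto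
    then show ?thesis unfolding sum_subtractf using finR by (simp add: residue_count_def sum.If_cases)
  qed
  finally have bad: "card (?R - R) \<le> (1 - q) * M * residue_count d A"
    using dense by (simp add: algebra_simps)
  \<comment> \<open>Translates of one class by representatives of all classes are disjoint inside
    \<open>A + A\<close>, so small doubling forbids large classes.\<close>
  have fibre_le: "real (card (fibre d A r)) \<le> K * card A / residue_count d A" for r
  proof -
    have "residue_count d A * card (fibre d A r) \<le> card (A + A)"
      using residue_count_mult_card_fibre_le A by blast
    then have "real (residue_count d A) * card (fibre d A r) \<le> K * card A"
      using K by (metis of_nat_le_iff of_nat_mult order_trans)
    then show ?thesis using cl by (simp add: pos_le_divide_eq mult.commute)
  qed
  have "A - A' \<subseteq> (\<Union>r\<in>?R - R. fibre d A r)" by (auto simp: A'_def fibre_def)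
  then have "card (A - A') \<le> card (\<Union>r\<in>?R - R. fibre d A r)"
    using A finR by (intro card_mono) auto
  also have "\<dots> \<le> (\<Sum>r\<in>?R - R. card (fibre d A r))" using finR by (intro card_UN_le) auto
  finally have "real (card (A - A')) \<le> (\<Sum>r\<in>?R - R. real (card (fibre d A r)))"
    by (metis of_nat_le_iff of_nat_sum)
  also have "\<dots> \<le> card (?R - R) * (K * card A / residue_count d A)"
    using fibre_le by (intro sum_bounded_above) auto
  also have "\<dots> \<le> ((1 - q) * M * residue_count d A) * (K * card A / residue_count d A)"
    using bad K0 by (intro mult_right_mono) auto
  also have "\<dots> = (1 - q) * M * K * card A" using cl by simp
  finally have "real (card A) - card A' \<le> (1 - q) * M * K * card A"
    using sub A by (simp add: card_Diff_subset finite_subset card_mono of_nat_diff)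
  then have "(1 - (1 - q) * M * K) * card A \<le> card A'" by (simp add: algebra_simps)
  then show ?thesis using sub full residue_count_mono[OF A(1) sub] by blast
qed

text \<open>The bound \<open>T = M ^ J\<close> on the number of classes depends on \<open>K\<close>,
  \<open>M\<close> and \<open>\<delta>\<close> only, because the chain length \<open>J\<close> is
  chosen before \<open>A\<close>.\<close>

lemma exists_regular_subset:
  fixes K \<delta> :: real and M :: nat
  assumes M: "M > 0" and \<delta>: "\<delta> > 0"
  shows "\<exists>T::nat. \<forall>A::int set. finite A \<longrightarrow> T < card A \<longrightarrow> card (A + uminus ` A) \<le> K * card A \<longrightarrow>
    (\<exists>d>0. \<exists>A'\<subseteq>A. full d M A' \<and> residue_count d A' \<le> T \<and> (1 - \<delta>) * card A \<le> card A')"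
proof -
  define r where "r = nat \<lfloor>K ^ 5\<rfloor>"
  \<comment> \<open>The growth bound at \<open>t = 2\<close>, so \<open>K2\<close> bounds the
    doubling \<open>card (A + A) / card A\<close>.\<close>
  define K2 where "K2 = \<bar>K\<bar> * 3 ^ r"
  have K2: "K2 \<ge> 0" by (simp add: K2_def)
  \<comment> \<open>With \<open>q = 1 - \<eta>\<close>, the loss \<open>(1 - q) * M * K2\<close> is
    at most \<open>\<delta>\<close>; the term \<open>+ 1\<close> keeps the denominator positive, and
    \<open>1 / 2\<close> keeps \<open>q\<close> positive.\<close>
  define \<eta> where "\<eta> = min (1 / 2) (\<delta> / (real M * K2 + 1))"
  have "real M * K2 + 1 > 0" using K2 by (intro add_nonneg_pos) auto
  then have \<eta>: "0 < \<eta>" "\<eta> < 1" "\<eta> \<le> \<delta> / (real M * K2 + 1)"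
    using \<delta> by (auto simp: \<eta>_def)
  then have "\<eta> * (real M * K2 + 1) \<le> \<delta>"
    using \<open>real M * K2 + 1 > 0\<close> by (simp only: pos_le_divide_eq)
  then have \<eta>M: "\<eta> * M * K2 \<le> \<delta>" using \<eta>(1) by (simp add: distrib_left mult.assoc)
  obtain J where J: "(1 - \<eta>) ^ J * (K * (real (J * M) + 2) ^ r) < 1"
    using exists_chain_length[of "1 - \<eta>" K M r] \<eta> by auto
  show ?thesis
  proof (intro exI[of _ "M ^ J"] allI impI)
    fix A :: "int set"
    assume A: "finite A" and big: "M ^ J < card A" and K: "card (A + uminus ` A) \<le> K * card A"
    have ne: "A \<noteq> {}" using big by auto
    have growth: "card (nsum t A) \<le> K * (real t + 1) ^ r * card A" for t
      unfolding r_def by (rule card_nsum_polynomial[OF A ne K])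
    obtain d where d: "d > 0" "residue_count d A \<le> M ^ J" "(1 - \<eta>) * M * residue_count d A < residue_count (d * int M) A"
      using exists_dense_modulus[OF A ne M _ _ big growth J] \<eta> by auto
    have "real (card (A + A)) \<le> K * 3 ^ r * card A"
    proof -
      have "nsum (Suc (Suc 0)) A = A + A" by (simp only: nsum.simps(2)[of "Suc 0"] nsum_1)
      then show ?thesis using growth[of "Suc (Suc 0)"] by (simp del: nsum.simps)
    qed
    also have "\<dots> \<le> K2 * card A" unfolding K2_def by (intro mult_right_mono) auto
    finally have K2': "card (A + A) \<le> K2 * card A" .
    obtain A' where A': "A' \<subseteq> A" "full d M A'" "residue_count d A' \<le> residue_count d A"
      "(1 - (1 - (1 - \<eta>)) * M * K2) * card A \<le> card A'"
      using exists_full_subset[OF A ne M d(1) _ _ order_less_imp_le[OF d(3)] K2'] \<eta> by auto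
    have "(1 - \<delta>) * card A \<le> (1 - (1 - (1 - \<eta>)) * M * K2) * card A"
      using \<eta>M by (intro mult_right_mono) auto
    then show "\<exists>d>0. \<exists>A'\<subseteq>A. full d M A' \<and> residue_count d A' \<le> M ^ J \<and> (1 - \<delta>) * card A \<le> card A'"
      using A' d by (intro exI[of _ d] exI[of _ A'] conjI) auto
  qed
qed

section \<open>Sums of dilates of saturated sets\<close>

text \<open>Every coefficient carries its own set, since dilates of different residue classes of
  \<open>A\<close> will be added.\<close>

definition dil_sum :: "(int \<times> int set) list \<Rightarrow> int set" where
  "dil_sum ps = (\<Sum>(l, B)\<leftarrow>ps. l *o B)"

lemma dil_sum_Nil [simp]: "dil_sum [] = {0}"
  by (simp add: dil_sum_def)

lemma dil_sum_Cons [simp]: "dil_sum ((l, B) # ps) = l *o B + dil_sum ps"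
  by (simp add: dil_sum_def)

lemma finite_dil_sum: "\<forall>(l, B)\<in>set ps. finite B \<Longrightarrow> finite (dil_sum ps)"
  by (induction ps) (auto intro!: finite_set_plus)

lemma dil_sum_mono: "X \<subseteq> Y \<Longrightarrow> dil_sum (map (\<lambda>l. (l, X)) ls) \<subseteq> dil_sum (map (\<lambda>l. (l, Y)) ls)"
proof (induction ls)
  case (Cons l ls)
  have "l *o X \<subseteq> l *o Y" using Cons.prems by (auto simp: elt_set_times_def)
  then show ?case using Cons by (simp add: set_plus_mono2)
qed simp

lemma mem_dil_sum_const:
  "z \<in> dil_sum (map (\<lambda>l. (l, X)) ls) \<Longrightarrow>
    \<exists>xs. length xs = length ls \<and> set xs \<subseteq> X \<and> z = (\<Sum>(l, x)\<leftarrow>zip ls xs. l * x)"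
proof (induction ls arbitrary: z)
  case (Cons l ls)
  then obtain x y where xy: "x \<in> X" "z = l * x + y" "y \<in> dil_sum (map (\<lambda>l. (l, X)) ls)"
    by (auto simp: elt_set_times_def elim!: set_plus_elim)
  obtain xs where "length xs = length ls" "set xs \<subseteq> X" "y = (\<Sum>(l, x)\<leftarrow>zip ls xs. l * x)"
    using Cons.IH[OF xy(3)] by blast
  then show ?case using xy by (intro exI[of _ "x # xs"]) auto
qed auto

text \<open>Lets classes modulo \<open>d\<close> be rescaled: their offsets combine into one
  translation, and the common factor \<open>d\<close> comes out.\<close>

lemma dil_sum_affine:
  "dil_sum (map (\<lambda>(l, c, B). (l, (\<lambda>y. c + d * y) ` B)) ts) =
    (\<lambda>z. (\<Sum>(l, c, B)\<leftarrow>ts. l * c) + d * z) ` dil_sum (map (\<lambda>(l, c, B). (l, B)) ts)"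
proof (induction ts)
  case (Cons t ts)
  obtain l c B where t: "t = (l, c, B)" by (metis surj_pair)
  let ?s = "\<Sum>(l, c, B)\<leftarrow>ts. l * c"
  have "l *o ((\<lambda>y. c + d * y) ` B) + (\<lambda>z. ?s + d * z) ` D =
      (\<lambda>z. l * c + ?s + d * z) ` (l *o B + D)" (is "?L = ?R") for D
  proof (intro equalityI subsetI)
    fix x assume "x \<in> ?L"
    then obtain b z where "b \<in> B" "z \<in> D" "x = l * (c + d * b) + (?s + d * z)"
      by (auto simp: elt_set_times_def elim!: set_plus_elim)
    then show "x \<in> ?R"
      by (intro image_eqI[of _ _ "l * b + z"]) (auto simp: elt_set_times_def algebra_simps)
  next
    fix x assume "x \<in> ?R"
    then obtain b z where bz: "b \<in> B" "z \<in> D" "x = l * c + ?s + d * (l * b + z)"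
      by (auto simp: elt_set_times_def elim!: set_plus_elim)
    then have x: "x = l * (c + d * b) + (?s + d * z)" by (simp add: algebra_simps)
    have "l * (c + d * b) \<in> l *o ((\<lambda>y. c + d * y) ` B)" using bz by (auto simp: elt_set_times_def)
    then show "x \<in> ?L" unfolding x using bz by (intro set_plus_intro) auto
  qed
  then show ?case using Cons by (simp add: t)
qed simp

lemma Gcd_dvd_dil_sum: "t \<in> dil_sum ps \<Longrightarrow> Gcd (fst ` set ps) dvd t"
proof (induction ps arbitrary: t)
  case (Cons p ps)
  obtain l B where p: "p = (l, B)" by (metis surj_pair)
  obtain b s where "t = l * b + s" "s \<in> dil_sum ps"
    using Cons.prems p by (auto simp: elt_set_times_def elim!: set_plus_elim)
  moreover have "gcd l (Gcd (fst ` set ps)) dvd s"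
    using Cons.IH \<open>s \<in> dil_sum ps\<close> by (blast intro: dvd_trans gcd_dvd2)
  ultimately show ?case by (simp add: p)
qed simp

text \<open>Bezout along the list: \<open>x\<close> is split into a multiple of the head and a
  multiple of the gcd of the tail, and both parts are reached modulo \<open>M\<close>.\<close>

lemma dil_sum_mod_surj:
  assumes "\<forall>(l, B)\<in>set ps. \<forall>z. \<exists>b\<in>B. b mod M = z mod M"
    and "Gcd (fst ` set ps) dvd x"
  shows "\<exists>t\<in>dil_sum ps. t mod M = (x::int) mod M"
  using assms
proof (induction ps arbitrary: x)
  case (Cons p ps)
  obtain l B where p: "p = (l, B)" by (metis surj_pair)
  let ?h = "Gcd (fst ` set ps)"
  obtain k where "x = gcd l ?h * k" using Cons.prems(2) p by (auto elim: dvdE)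
  moreover obtain u v where "u * l + v * ?h = gcd l ?h" using bezout_int by blast
  ultimately have "x = (u * l + v * ?h) * k" by simp
  then have x: "x = l * (u * k) + ?h * (v * k)" by (simp add: algebra_simps)
  have "\<forall>z. \<exists>b\<in>B. b mod M = z mod M" using Cons.prems(1) p by simp
  then obtain b where b: "b \<in> B" "b mod M = (u * k) mod M" by blast
  obtain t where t: "t \<in> dil_sum ps" "t mod M = (?h * (v * k)) mod M"
    using Cons.IH[of "?h * (v * k)"] Cons.prems(1) by auto
  have "l * b + t \<in> dil_sum (p # ps)" using b t p by (auto simp: elt_set_times_def)
  moreover have "(l * b + t) mod M = x mod M"
    using b(2) t(2) unfolding x by (intro mod_add_cong mod_mult_cong) auto
  ultimately show ?case by blast
qed auto

section \<open>Cardinality of sums of dilates of sets meeting all residues\<close>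

lemma card_residues:
  fixes q :: int
  assumes "q > 0" and "\<forall>z. \<exists>u\<in>U. u mod q = z mod q"
  shows "card ((\<lambda>u. u mod q) ` U) = nat q"
proof -
  have "z \<in> (\<lambda>u. u mod q) ` U" if "0 \<le> z" "z < q" for z
  proof -
    obtain u where "u \<in> U" "u mod q = z mod q" using assms by blast
    then show ?thesis using that by (auto intro!: rev_image_eqI)
  qed
  then have "(\<lambda>u. u mod q) ` U = {0..<q}" using assms(1) by auto
  then show ?thesis by simp
qed

text \<open>By coprimality, \<open>p * u + q * v\<close> determines \<open>u\<close> modulo
  \<open>q\<close> and \<open>v\<close> modulo \<open>p\<close>, so the pieces indexed by pairs of
  classes are disjoint. Each piece is a sum of two nonempty finite sets of integers.\<close>

lemma card_two_dilates_ge: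
  fixes p q :: int
  assumes cop: "coprime p q" and nz: "p \<noteq> 0" "q \<noteq> 0" and fin: "finite U" "finite V"
    and U: "\<forall>z. \<exists>u\<in>U. u mod \<bar>q\<bar> = z mod \<bar>q\<bar>" and V: "\<forall>z. \<exists>v\<in>V. v mod \<bar>p\<bar> = z mod \<bar>p\<bar>"
  shows "\<bar>p\<bar> * int (card U) + \<bar>q\<bar> * int (card V) \<le> int (card (p *o U + q *o V)) + \<bar>p\<bar> * \<bar>q\<bar>"
proof -
  let ?I = "(\<lambda>u. u mod \<bar>q\<bar>) ` U"
  let ?J = "(\<lambda>v. v mod \<bar>p\<bar>) ` V"
  let ?U = "fibre \<bar>q\<bar> U"
  let ?V = "fibre \<bar>p\<bar> V"
  define W where "W = (\<lambda>(i, j). p *o ?U i + q *o ?V j)"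
  have cI: "int (card ?I) = \<bar>q\<bar>" using card_residues[OF _ U] nz by simp
  have cJ: "int (card ?J) = \<bar>p\<bar>" using card_residues[OF _ V] nz by simp
  have finW: "finite (W x)" for x using fin by (auto simp: W_def split: prod.split intro!: finite_set_plus)
  have cW: "int (card (?U i)) + int (card (?V j)) - 1 \<le> int (card (W (i, j)))" if "i \<in> ?I" "j \<in> ?J" for i j
  proof -
    have "?U i \<noteq> {}" "?V j \<noteq> {}" using that by (auto simp: fibre_def)
    then have "card (p *o ?U i) + card (q *o ?V j) \<le> card (W (i, j)) + 1"
      unfolding W_def prod.case using fin by (intro card_plus_int_ge) auto
    then show ?thesis using nz by (simp add: card_elt_set_times)
  qed
  have "W x \<inter> W y = {}" if "x \<noteq> y" for x y
  proof (rule ccontr)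
    obtain i j i' j' where xy: "x = (i, j)" "y = (i', j')" by (metis surj_pair)
    assume "W x \<inter> W y \<noteq> {}"
    then obtain z where z: "z \<in> W x" "z \<in> W y" by blast
    obtain u v where 1: "u \<in> ?U i" "v \<in> ?V j" "z = p * u + q * v"
      using z(1) by (auto simp: W_def xy elt_set_times_def elim!: set_plus_elim)
    obtain u' v' where 2: "u' \<in> ?U i'" "v' \<in> ?V j'" "z = p * u' + q * v'"
      using z(2) by (auto simp: W_def xy elt_set_times_def elim!: set_plus_elim)
    have "p * (u - u') = q * (v' - v)" "q * (v - v') = p * (u' - u)"
      using 1(3) 2(3) by (simp_all add: algebra_simps)
    then have "q dvd p * (u - u')" "p dvd q * (v - v')" by (simp_all only: dvd_triv_left)
    then have "q dvd u - u'" "p dvd v - v'"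
      using coprime_dvd_mult_right_iff[of q p "u - u'"] coprime_dvd_mult_right_iff[of p q "v - v'"] cop
      by (simp_all add: coprime_commute)
    then have "u mod \<bar>q\<bar> = u' mod \<bar>q\<bar>" "v mod \<bar>p\<bar> = v' mod \<bar>p\<bar>"
      by (simp_all add: mod_eq_dvd_iff)
    then have "i = i'" "j = j'" using 1(1,2) 2(1,2) by (auto simp: fibre_def)
    then show False using that xy by simp
  qed
  then have "card (\<Union>x\<in>?I \<times> ?J. W x) = (\<Sum>x\<in>?I \<times> ?J. card (W x))"
    using fin finW by (intro card_UN_disjoint) auto
  moreover have "W x \<subseteq> p *o U + q *o V" for x
    unfolding W_def by (cases x) (simp add: set_plus_mono2 set_times_mono fibre_subset)
  then have "(\<Union>x\<in>?I \<times> ?J. W x) \<subseteq> p *o U + q *o V" by blast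
  then have "card (\<Union>x\<in>?I \<times> ?J. W x) \<le> card (p *o U + q *o V)"
    using fin by (intro card_mono finite_set_plus) auto
  ultimately have "(\<Sum>x\<in>?I \<times> ?J. int (card (W x))) \<le> int (card (p *o U + q *o V))"
    by (metis of_nat_le_iff of_nat_sum)
  moreover have "(\<Sum>x\<in>?I \<times> ?J. int (card (W x))) = (\<Sum>i\<in>?I. \<Sum>j\<in>?J. int (card (W (i, j))))"
    by (simp add: sum.cartesian_product)
  moreover have "(\<Sum>i\<in>?I. \<Sum>j\<in>?J. int (card (?U i)) + int (card (?V j)) - 1) \<le>
      (\<Sum>i\<in>?I. \<Sum>j\<in>?J. int (card (W (i, j))))"
    using cW by (intro sum_mono) auto
  \<comment> \<open>Each class of \<open>U\<close> is counted once for each of the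
    \<open>\<bar>p\<bar>\<close> classes of \<open>V\<close>, and conversely; the terms
    \<open>- 1\<close> add up to the error \<open>\<bar>p\<bar> * \<bar>q\<bar>\<close>.\<close>
  moreover have "(\<Sum>i\<in>?I. \<Sum>j\<in>?J. int (card (?U i)) + int (card (?V j)) - 1) =
      \<bar>p\<bar> * int (card U) + \<bar>q\<bar> * int (card V) - \<bar>p\<bar> * \<bar>q\<bar>"
    using cI cJ card_fibre_sum[OF fin(1), of "\<bar>q\<bar>"] card_fibre_sum[OF fin(2), of "\<bar>p\<bar>"]
    by (simp add: sum.distrib sum_subtractf sum_distrib_left[symmetric] mult.commute)
  ultimately show ?thesis by linarith
qed

text \<open>Induction on the list. The sum over the tail is \<open>h *o V\<close> for the gcd
  \<open>h\<close> of the tail; after division by \<open>g = gcd l h\<close> the estimate for two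
  coprime dilates applies to \<open>B\<close> and \<open>V\<close>. Weights are divided by the gcd
  because the tail of a coprime list need not be coprime.\<close>

lemma card_dil_sum_ge:
  fixes ls :: "int list" and M :: int
  assumes "ls \<noteq> []" "\<forall>l\<in>set ls. l \<noteq> 0 \<and> l dvd M"
  shows "\<exists>C\<ge>0. \<forall>ps. map fst ps = ls \<longrightarrow> (\<forall>(l, B)\<in>set ps. finite B \<and> (\<forall>z. \<exists>b\<in>B. b mod M = z mod M)) \<longrightarrow>
    (\<Sum>(l, B)\<leftarrow>ps. \<bar>l\<bar> div Gcd (set ls) * int (card B)) \<le> int (card (dil_sum ps)) + C"
  using assms
proof (induction ls rule: list_nonempty_induct)
  case (single l)
  have *: "(\<Sum>(m, B)\<leftarrow>ps. \<bar>m\<bar> div Gcd (set [l]) * int (card B)) \<le> int (card (dil_sum ps)) + 0"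
    if fst: "map fst ps = [l]" for ps
  proof -
    obtain x where x: "ps = [x]" using fst by (cases ps) auto
    then have "ps = [(l, snd x)]" using fst by (cases x) auto
    then show ?thesis using single by (simp add: card_elt_set_times flip: set_zero)
  qed
  show ?case by (intro exI[of _ 0] conjI allI impI order_refl) (erule *)
next
  case (cons l ls)
  define h where "h = Gcd (set ls)"
  define g where "g = gcd l h"
  have "\<forall>l\<in>set ls. l \<noteq> 0 \<and> l dvd M" using cons.prems by simp
  from cons.IH[OF this] obtain C where C: "C \<ge> 0" and IH: "\<forall>ps. map fst ps = ls \<longrightarrow>
      (\<forall>(l, B)\<in>set ps. finite B \<and> (\<forall>z. \<exists>b\<in>B. b mod M = z mod M)) \<longrightarrow>
      (\<Sum>(l, B)\<leftarrow>ps. \<bar>l\<bar> div h * int (card B)) \<le> int (card (dil_sum ps)) + C"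
    unfolding h_def by (elim exE conjE)
  have l: "l \<noteq> 0" "l dvd M" using cons by auto
  obtain l' where l': "l' \<in> set ls" using cons(1) by (cases ls) auto
  have "h dvd l'" unfolding h_def using l' by (rule Gcd_dvd)
  then have "h \<noteq> 0" "h dvd M" using cons.prems l' by (auto intro: dvd_trans)
  then have h: "h > 0" "h dvd M" unfolding h_def using Gcd_int_greater_eq_0[of "set ls"] by linarith+
  have g: "g > 0" using l by (simp add: g_def)
  define p q where "p = l div g" "q = h div g"
  have pq: "l = g * p" "h = g * q" by (simp_all add: p_q_def g_def)
  have q: "q > 0" using pq h g by (metis zero_less_mult_pos)
  have p: "p \<noteq> 0" using pq l by auto
  have cop: "coprime p q" unfolding p_q_def g_def using l by (intro div_gcd_coprime) simp
  \<comment> \<open>Up to sign, \<open>p * h = g * p * q\<close> is the lcm of \<open>l\<close> and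
    \<open>h\<close>. Divisibility of \<open>M\<close> by it is what later makes \<open>V\<close>
    meet every class modulo \<open>p\<close>.\<close>
  have phM: "p * h dvd M"
  proof -
    obtain M' where M': "M = g * M'" using l(2) unfolding pq by (metis dvd_def dvd_mult_left)
    have "p dvd M'" "q dvd M'" using l(2) h(2) g unfolding pq M' by auto
    then have "p * q dvd M'" using cop by (simp add: divides_mult)
    then show ?thesis unfolding pq M' by (simp add: mult.left_commute)
  qed
  \<comment> \<open>The tail enters with weight \<open>q\<close>, which scales its error to
    \<open>q * C\<close>; the sum of two dilates adds \<open>\<bar>p\<bar> * q\<close>.\<close>
  have "(\<Sum>(l, B)\<leftarrow>ps. \<bar>l\<bar> div g * int (card B)) \<le> int (card (dil_sum ps)) + (q * C + \<bar>p\<bar> * q)"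
    if fst: "map fst ps = l # ls"
      and good: "\<forall>(l, B)\<in>set ps. finite B \<and> (\<forall>z. \<exists>b\<in>B. b mod M = z mod M)" for ps
  proof -
    obtain x qs where x: "ps = x # qs" using fst by (cases ps) auto
    obtain B where ps: "ps = (l, B) # qs" "map fst qs = ls" using fst x by (cases x) auto
    have B: "finite B" "\<forall>z. \<exists>b\<in>B. b mod M = z mod M"
      and qs: "\<forall>(l, B)\<in>set qs. finite B \<and> (\<forall>z. \<exists>b\<in>B. b mod M = z mod M)"
      using good unfolding ps by simp_all
    define T where "T = dil_sum qs"
    define V where "V = {v. h * v \<in> T}"
    have fsts: "fst ` set qs = set ls" using ps(2)[symmetric] by simp
    have T: "T = h *o V"
      using Gcd_dvd_dil_sum[of _ qs] unfolding fsts h_def[symmetric] T_def[symmetric]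
      by (fastforce simp: V_def elt_set_times_def elim: dvdE)
    have finT: "finite T" unfolding T_def using qs by (intro finite_dil_sum) auto
    have "inj_on ((*) h) V" using h by (auto simp: inj_on_def)
    moreover have "(*) h ` V \<subseteq> T" by (auto simp: V_def)
    ultimately have finV: "finite V" using finT by (meson finite_imageD finite_subset)
    have cV: "card T = card V" unfolding T using h by (simp add: card_elt_set_times)
    have eq: "dil_sum ps = g *o (p *o B + q *o V)"
    proof -
      have "dil_sum ps = l *o B + h *o V" by (simp add: ps T_def[symmetric] T)
      also have "\<dots> = g *o (p *o B + q *o V)"
        unfolding pq by (simp add: set_times_plus_distrib2 set_times_rearrange2)
      finally show ?thesis .
    qed
    have "int (card (dil_sum ps)) = int (card (p *o B + q *o V))"
      unfolding eq using g by (simp add: card_elt_set_times)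
    moreover have "\<bar>p\<bar> * int (card B) + \<bar>q\<bar> * int (card V) \<le> int (card (p *o B + q *o V)) + \<bar>p\<bar> * \<bar>q\<bar>"
    proof (rule card_two_dilates_ge[OF cop p _ B(1) finV])
      show "\<forall>z. \<exists>u\<in>B. u mod \<bar>q\<bar> = z mod \<bar>q\<bar>"
      proof
        fix z
        obtain b where "b \<in> B" "b mod M = z mod M" using B(2) by blast
        moreover have "\<bar>q\<bar> dvd M" using pq(2) h(2) by (metis abs_dvd_iff dvd_mult_right)
        ultimately show "\<exists>u\<in>B. u mod \<bar>q\<bar> = z mod \<bar>q\<bar>" using mod_eq_mod_of_dvd by blast
      qed
      show "\<forall>z. \<exists>v\<in>V. v mod \<bar>p\<bar> = z mod \<bar>p\<bar>"
      proof
        fix z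
        have "\<forall>(l, B)\<in>set qs. \<forall>z. \<exists>b\<in>B. b mod M = z mod M" using qs by blast
        moreover have "Gcd (fst ` set qs) dvd h * z" unfolding fsts h_def by simp
        ultimately have "\<exists>t\<in>T. t mod M = (h * z) mod M" unfolding T_def by (rule dil_sum_mod_surj)
        then obtain t where t: "t \<in> T" "t mod M = (h * z) mod M" by blast
        obtain v where v: "t = h * v" "v \<in> V" using t(1) unfolding T by (auto simp: elt_set_times_def)
        have "p * h dvd h * v - h * z" using t(2) v phM by (metis dvd_trans mod_eq_dvd_iff)
        then have "h * p dvd h * (v - z)" by (simp add: algebra_simps)
        then have "p dvd v - z" using h by simp
        then show "\<exists>v\<in>V. v mod \<bar>p\<bar> = z mod \<bar>p\<bar>" using v by (auto simp: mod_eq_dvd_iff)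
      qed
    qed (use q in auto)
    moreover have "(\<Sum>(l, B)\<leftarrow>qs. \<bar>l\<bar> div g * int (card B)) = q * (\<Sum>(l, B)\<leftarrow>qs. \<bar>l\<bar> div h * int (card B))"
      unfolding sum_list_const_mult[symmetric]
    proof (intro arg_cong[of _ _ sum_list] map_cong refl)
      fix x assume x: "x \<in> set qs"
      obtain l' B' where x': "x = (l', B')" by (metis surj_pair)
      then have "l' \<in> set ls" using x fsts by force
      then have "h dvd \<bar>l'\<bar>" unfolding h_def by simp
      then obtain k where k: "\<bar>l'\<bar> = h * k" by (rule dvdE)
      then have "\<bar>l'\<bar> div g = q * k" using g unfolding pq by (simp add: mult.assoc)
      moreover have "\<bar>l'\<bar> div h = k" using k h by simp
      ultimately show "(case x of (l, B) \<Rightarrow> \<bar>l\<bar> div g * int (card B)) =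
          q * (case x of (l, B) \<Rightarrow> \<bar>l\<bar> div h * int (card B))" by (simp add: x')
    qed
    moreover have "q * (\<Sum>(l, B)\<leftarrow>qs. \<bar>l\<bar> div h * int (card B)) \<le> q * (int (card T) + C)"
      unfolding T_def using q qs IH ps(2) by (intro mult_left_mono) simp_all
    moreover have "\<bar>l\<bar> div g = \<bar>p\<bar>" using g unfolding pq by (simp add: abs_mult)
    ultimately show ?thesis using q cV by (simp add: ps algebra_simps)
  qed
  then show ?case using C q
    by (intro exI[of _ "q * C + \<bar>p\<bar> * q"]) (auto simp: g_def h_def)
qed

section \<open>Residues of sums of dilates\<close>

lemma residue_count_image_eq:
  assumes "\<And>x y. x \<in> Z \<Longrightarrow> y \<in> Z \<Longrightarrow> f x mod n = f y mod n \<longleftrightarrow> x mod m = y mod m"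
  shows "residue_count n (f ` Z) = residue_count m Z"
proof -
  define g where "g = (\<lambda>s. f (inv_into Z (\<lambda>x. x mod m) s) mod n)"
  have g: "g (x mod m) = f x mod n" if "x \<in> Z" for x
  proof -
    have "x mod m \<in> (\<lambda>x. x mod m) ` Z" using that by blast
    from inv_into_into[OF this] f_inv_into_f[OF this] show ?thesis
      unfolding g_def using assms that by blast
  qed
  have "(\<lambda>x. x mod n) ` f ` Z = g ` (\<lambda>x. x mod m) ` Z"
    unfolding image_image by (rule image_cong) (simp_all add: g)
  moreover have "inj_on g ((\<lambda>x. x mod m) ` Z)"
    using assms by (intro inj_onI) (auto simp: g)
  ultimately show ?thesis unfolding residue_count_def by (simp add: card_image)
qed

lemma residue_count_affine:
  assumes "n1 > 0"
  shows "residue_count (n1 * n2) ((\<lambda>z. s + n1 * z) ` Z) = residue_count n2 Z"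
proof (rule residue_count_image_eq)
  fix x y
  have "n1 * n2 dvd n1 * (x - y) \<longleftrightarrow> n2 dvd x - y" using assms by simp
  then show "(s + n1 * x) mod (n1 * n2) = (s + n1 * y) mod (n1 * n2) \<longleftrightarrow> x mod n2 = y mod n2"
    by (simp add: mod_eq_dvd_iff right_diff_distrib)
qed

lemma fibre_eq_image:
  assumes "d > 0"
  shows "fibre d A r = (\<lambda>y. r mod d + d * y) ` {y. r mod d + d * y \<in> fibre d A r}"
proof (intro equalityI subsetI)
  fix x assume x: "x \<in> fibre d A r"
  then have "x = r mod d + d * (x div d)" by (auto simp: fibre_def)
  then show "x \<in> (\<lambda>y. r mod d + d * y) ` {y. r mod d + d * y \<in> fibre d A r}"
    using x by (intro image_eqI[of _ _ "x div d"]) auto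
qed auto

text \<open>Each prime factor of \<open>n\<close> goes to \<open>n2\<close> if it divides
  \<open>l\<close>, and to \<open>n1\<close> otherwise; a prime dividing \<open>l\<close> cannot
  divide \<open>h\<close> as well.\<close>

lemma coprime_factorisation:
  fixes l h :: int and n :: nat
  assumes "n > 0" "coprime (gcd l h) (int n)"
  shows "\<exists>n1 n2. n1 > 0 \<and> n2 > 0 \<and> n = n1 * n2 \<and> coprime l (int n1) \<and> coprime h (int n2)"
  using assms
proof (induction n rule: less_induct)
  case (less n)
  show ?case
  proof (cases "n = 1")
    case True
    then show ?thesis by (intro exI[of _ 1]) simp
  next
    case False
    then obtain p m where p: "prime p" "n = p * m" by (metis prime_factor_nat dvdE)
    have m: "m > 0" "m < n" using less.prems p prime_gt_1_nat[of p] by auto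
    have cop: "coprime (gcd l h) (int p)" "coprime (gcd l h) (int m)" using less.prems p by auto
    obtain m1 m2 where IH: "m1 > 0" "m2 > 0" "m = m1 * m2" "coprime l (int m1)" "coprime h (int m2)"
      using less.IH[OF m(2,1) cop(2)] by blast
    have prime: "prime (int p)" using p by simp
    show ?thesis
    proof (cases "int p dvd l")
      case True
      have "\<not> int p dvd h"
      proof
        assume "int p dvd h"
        then have "int p dvd gcd l h" using True by simp
        then have "is_unit (int p)" by (rule coprime_common_divisor[OF cop(1) _ dvd_refl])
        then show False using prime not_prime_unit by blast
      qed
      then have "coprime h (int p)"
        using prime_imp_coprime[OF prime, of h] by (simp add: coprime_commute)
      then show ?thesis using IH p prime_gt_0_nat[of p]
        by (intro exI[of _ m1] exI[of _ "p * m2"]) (simp add: mult.left_commute)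
    next
      case False
      then have "coprime l (int p)"
        using prime_imp_coprime[OF prime, of l] by (simp add: coprime_commute)
      then show ?thesis using IH p prime_gt_0_nat[of p]
        by (intro exI[of _ "p * m1"] exI[of _ m2]) (simp add: mult.assoc)
    qed
  qed
qed

lemma dil_sum_affine_const:
  "\<exists>s. dil_sum (map (\<lambda>l. (l, (\<lambda>y. c + d * y) ` Y)) ls) = (\<lambda>z. s + d * z) ` dil_sum (map (\<lambda>l. (l, Y)) ls)"
  using dil_sum_affine[of d "map (\<lambda>l. (l, c, Y)) ls"]
  by (simp add: comp_def) blast

text \<open>
  It is essential that all dilates are of the same set \<open>X\<close>: for different sets the analogous bound by
  the smallest \<open>residue_count\<close> fails (\<open>2 *o {0, 3} + 3 *o {0, 2}\<close> modulo 6).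
\<close>

lemma residue_count_dil_sum_ge:
  fixes ls :: "int list"
  assumes "finite X" "n > 0" "coprime (Gcd (set ls)) (int n)"
  shows "residue_count (int n) X \<le> residue_count (int n) (dil_sum (map (\<lambda>l. (l, X)) ls))"
  using assms
proof (induction ls arbitrary: X n)
  case Nil
  \<comment> \<open>The gcd of the empty list is 0, which is coprime only to 1.\<close>
  then have "n = 1" by simp
  then show ?case by (simp add: residue_count_def image_constant_conv)
next
  case (Cons l ls)
  let ?S = "\<lambda>X. dil_sum (map (\<lambda>l. (l, X)) ls)"
  have finS: "finite (?S Y)" if "finite Y" for Y using that by (intro finite_dil_sum) auto
  show ?case
  proof (cases "X = {}")
    case False
    \<comment> \<open>Modulo \<open>n1\<close> the head \<open>l\<close> is invertible, so
      \<open>l *o X\<close> keeps all residues of \<open>X\<close>. Inside a richest class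
      \<open>?F\<close> modulo \<open>n1\<close>, rescaling turns the modulus into
      \<open>n2\<close>, which is coprime to the gcd of the tail, so induction applies. The tail sum
      of \<open>?F\<close> stays in one class modulo \<open>n1\<close>, and the two counts
      multiply.\<close>
    obtain n1 n2 where n: "n1 > 0" "n2 > 0" "n = n1 * n2" "coprime l (int n1)" "coprime (Gcd (set ls)) (int n2)"
      using coprime_factorisation[of n l "Gcd (set ls)"] Cons.prems by auto
    have dvd: "int n1 dvd int n" using n by simp
    obtain r where r: "r \<in> (\<lambda>x. x mod int n1) ` X"
      "residue_count (int n) X \<le> residue_count (int n1) X * residue_count (int n) (fibre (int n1) X r)"
      using exists_large_fibre[OF Cons.prems(1) False dvd] by blast
    let ?F = "fibre (int n1) X r"
    define Y where "Y = {y. r mod int n1 + int n1 * y \<in> ?F}"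
    have F: "?F = (\<lambda>y. r mod int n1 + int n1 * y) ` Y"
      unfolding Y_def using n by (intro fibre_eq_image) simp
    have "inj_on (\<lambda>y. r mod int n1 + int n1 * y) Y" using n by (auto simp: inj_on_def)
    then have finY: "finite Y" using F Cons.prems(1) by (metis finite_fibre finite_imageD)
    obtain s where s: "?S ?F = (\<lambda>z. s + int n1 * z) ` ?S Y"
      using dil_sum_affine_const unfolding F by blast
    have "residue_count (int n) ?F = residue_count (int n2) Y"
      unfolding F n(3) of_nat_mult using n by (intro residue_count_affine) simp
    also have "\<dots> \<le> residue_count (int n2) (?S Y)" using finY n by (intro Cons.IH)
    also have "\<dots> = residue_count (int n) (?S ?F)"
      unfolding s n(3) of_nat_mult using n by (intro residue_count_affine[symmetric]) simp
    finally have 1: "residue_count (int n) ?F \<le> residue_count (int n) (?S ?F)" .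
    have img: "l *o X = (\<lambda>x. l * x) ` X" by (auto simp: elt_set_times_def)
    have 2: "residue_count (int n1) (l *o X) = residue_count (int n1) X"
      unfolding img
    proof (rule residue_count_image_eq)
      fix x y
      have "int n1 dvd l * (x - y) \<longleftrightarrow> int n1 dvd x - y"
        using n(4) by (simp add: coprime_dvd_mult_right_iff coprime_commute)
      then show "l * x mod int n1 = l * y mod int n1 \<longleftrightarrow> x mod int n1 = y mod int n1"
        by (simp add: mod_eq_dvd_iff right_diff_distrib)
    qed
    have const: "x mod int n1 = y mod int n1" if xy: "x \<in> ?S ?F" "y \<in> ?S ?F" for x y
    proof -
      obtain x' y' where "x = s + int n1 * x'" "y = s + int n1 * y'" using xy s by auto
      then show ?thesis by simp
    qed
    have "residue_count (int n) X \<le> residue_count (int n1) (l *o X) * residue_count (int n) (?S ?F)"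
      using r(2) mult_le_mono2[OF 1, of "residue_count (int n1) X"] unfolding 2 by linarith
    also have "\<dots> \<le> residue_count (int n) (l *o X + ?S ?F)"
      using Cons.prems(1) finS by (intro residue_count_plus_ge[OF dvd _ _ const]) auto
    also have "\<dots> \<le> residue_count (int n) (l *o X + ?S X)"
      using Cons.prems(1) finS
      by (intro residue_count_mono finite_set_plus set_plus_mono2 dil_sum_mono fibre_subset) auto
    finally show ?thesis by simp
  qed (simp add: residue_count_def)
qed

text \<open>
  Used with \<open>G Q\<close> the residues reached by sums of dilates of \<open>Q\<close> and \<open>w\<close> the fibre sizes: each class \<open>r\<close>
  gets its own residue, reached from classes at least as large as that of \<open>r\<close>.
\<close>

lemma exists_greedy_transversal:
  fixes w :: "'a \<Rightarrow> nat" and G :: "'a set \<Rightarrow> 'b set"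
  assumes "finite R" and "\<And>Q. Q \<subseteq> R \<Longrightarrow> finite (G Q) \<and> card Q \<le> card (G Q)"
    and "\<And>P Q. P \<subseteq> Q \<Longrightarrow> G P \<subseteq> G Q"
  shows "\<exists>\<sigma>. inj_on \<sigma> R \<and> (\<forall>r\<in>R. \<sigma> r \<in> G {x \<in> R. w r \<le> w x})"
  using assms(1,2)
proof (induction R rule: finite_ranking_induct[where f = "\<lambda>x. - int (w x)"])
  case (insert x S)
  show ?case
  proof (cases "x \<in> S")
    case True
    then show ?thesis using insert by (simp add: insert_absorb)
  next
    case False
    obtain \<sigma> where \<sigma>: "inj_on \<sigma> S" "\<forall>r\<in>S. \<sigma> r \<in> G {x \<in> S. w r \<le> w x}"
      using insert.IH insert.prems by (meson subset_insertI2)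
    \<comment> \<open>Elements are inserted by decreasing weight, so \<open>x\<close> may use any
      value in \<open>G (insert x S)\<close>. This set has more elements than the values already
      taken.\<close>
    have "card (\<sigma> ` S) < card (insert x S)"
      using insert False by (simp add: card_image[OF \<sigma>(1)])
    also have "\<dots> \<le> card (G (insert x S))" using insert.prems[of "insert x S"] by simp
    finally have "\<not> G (insert x S) \<subseteq> \<sigma> ` S"
      using insert(1) by (meson card_mono finite_imageI not_le)
    then obtain y where y: "y \<in> G (insert x S)" "y \<notin> \<sigma> ` S" by blast
    have all: "{z \<in> insert x S. w x \<le> w z} = insert x S" using insert(2) by auto
    have sub: "{z \<in> S. w r \<le> w z} \<subseteq> {z \<in> insert x S. w r \<le> w z}" for r by auto
    have "inj_on (\<sigma>(x := y)) (insert x S)"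
      using \<sigma>(1) y(2) False by (auto simp: inj_on_def)
    moreover have "(\<sigma>(x := y)) r \<in> G {z \<in> insert x S. w r \<le> w z}" if r: "r \<in> insert x S" for r
    proof (cases "r = x")
      case True
      then show ?thesis using y(1) all by simp
    next
      case False
      then have "\<sigma> r \<in> G {z \<in> S. w r \<le> w z}" using \<sigma>(2) r by blast
      then have "\<sigma> r \<in> G {z \<in> insert x S. w r \<le> w z}" using assms(3)[OF sub] by blast
      then show ?thesis using False by simp
    qed
    ultimately show ?thesis by blast
  qed
qed auto

section \<open>Assembling the classes of a saturated set\<close>

lemma dil_sum_mono_zip:
  "(\<And>l x. (l, x) \<in> set zs \<Longrightarrow> F x \<subseteq> A) \<Longrightarrow>
    dil_sum (map (\<lambda>(l, x). (l, F x)) zs) \<subseteq> dil_sum (map (\<lambda>(l, x). (l, A)) zs)"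
proof (induction zs)
  case (Cons z zs)
  obtain l x where z: "z = (l, x)" by (metis surj_pair)
  have "l *o F x \<subseteq> l *o A" using Cons.prems[of l x] z by (intro set_times_mono) simp
  moreover have "dil_sum (map (\<lambda>(l, x). (l, F x)) zs) \<subseteq> dil_sum (map (\<lambda>(l, x). (l, A)) zs)"
    using Cons.prems by (intro Cons.IH) (meson list.set_intros(2))
  ultimately show ?case by (simp add: z set_plus_mono2)
qed simp

text \<open>After rescaling by \<open>d\<close>, a saturated class meets every residue modulo
  \<open>M\<close>, which is what \<open>card_dil_sum_ge\<close> asks of its sets.\<close>

lemma full_fibre_surj:
  assumes "full d M A" "d > 0" "r \<in> (\<lambda>a. a mod d) ` A"
  shows "\<exists>b\<in>{y. r mod d + d * y \<in> fibre d A r}. b mod int M = z mod int M"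
proof -
  have r: "r mod d = r" using assms(3) by auto
  then have x: "(r + d * z) mod d = r" by simp
  then obtain a where a: "a \<in> A" "(r + d * z) mod (d * int M) = a mod (d * int M)"
    using assms(1,3) unfolding full_def by (metis (no_types, lifting) imageE)
  have ad: "a mod d = r" using mod_eq_mod_of_dvd[OF a(2), of d] x by simp
  then have aeq: "a = r + d * (a div d)" by (metis mod_mult_div_eq)
  have "d * int M dvd (r + d * z) - (r + d * (a div d))"
    using a(2) aeq unfolding mod_eq_dvd_iff by simp
  then have "d * int M dvd d * (z - a div d)" by (simp add: algebra_simps)
  then have "int M dvd z - a div d" using assms(2) by simp
  then have "(a div d) mod int M = z mod int M" by (simp add: mod_eq_dvd_iff dvd_diff_commute)
  moreover have "r mod d + d * (a div d) \<in> fibre d A r" using a(1) ad aeq r by (auto simp: fibre_def)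
  ultimately show ?thesis by blast
qed

text \<open>The transversal gives each class \<open>r\<close> its own residue
  \<open>\<sigma> r\<close>, reached by a combination of classes at least as large as that of
  \<open>r\<close>. The corresponding sum of dilates has the size expected for \<open>r\<close> up
  to \<open>C\<close>, and these sums are disjoint.\<close>

lemma card_dil_sum_full_ge:
  fixes ls :: "int list" and M :: nat
  assumes ls: "ls \<noteq> []" "\<forall>l\<in>set ls. l \<noteq> 0 \<and> l dvd int M" and Gcd: "Gcd (set ls) = 1"
  shows "\<exists>C\<ge>0. \<forall>A d. finite A \<longrightarrow> d > 0 \<longrightarrow> full d M A \<longrightarrow>
    (\<Sum>l\<leftarrow>ls. \<bar>l\<bar>) * int (card A) \<le> int (card (dil_sum (map (\<lambda>l. (l, A)) ls))) + C * int (residue_count d A)"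
proof -
  from card_dil_sum_ge[OF ls] obtain C where C: "C \<ge> 0" and bound: "\<forall>ps. map fst ps = ls \<longrightarrow>
      (\<forall>(l, B)\<in>set ps. finite B \<and> (\<forall>z. \<exists>b\<in>B. b mod int M = z mod int M)) \<longrightarrow>
      (\<Sum>(l, B)\<leftarrow>ps. \<bar>l\<bar> div Gcd (set ls) * int (card B)) \<le> int (card (dil_sum ps)) + C"
    by (elim exE conjE)
  have "(\<Sum>l\<leftarrow>ls. \<bar>l\<bar>) * int (card A) \<le> int (card (dil_sum (map (\<lambda>l. (l, A)) ls))) + C * int (residue_count d A)"
    if A: "finite A" and d: "d > 0" and full: "full d M A" for A d
  proof -
    let ?S = "\<lambda>X. dil_sum (map (\<lambda>l. (l, X)) ls)"
    let ?R = "(\<lambda>a. a mod d) ` A"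
    define w where "w = (\<lambda>r. card (fibre d A r))"
    define B where "B = (\<lambda>r. {y. r mod d + d * y \<in> fibre d A r})"
    have fibre: "fibre d A r = (\<lambda>y. r mod d + d * y) ` B r" for r
      unfolding B_def by (rule fibre_eq_image[OF d])
    have inj: "inj_on (\<lambda>y. s + d * y) X" for s X using d by (auto simp: inj_on_def)
    have finB: "finite (B r)" for r
      using fibre[of r] inj A by (metis finite_fibre finite_imageD)
    have cB: "card (B r) = w r" for r
      unfolding w_def fibre by (rule card_image[OF inj, symmetric])
    have Rmod: "r mod d = r" if "r \<in> ?R" for r using that by auto
    have finS: "finite (?S X)" if "finite X" for X using that by (intro finite_dil_sum) auto
    define G where "G = (\<lambda>Q. (\<lambda>x. x mod d) ` ?S Q)"
    have "\<exists>\<sigma>. inj_on \<sigma> ?R \<and> (\<forall>r\<in>?R. \<sigma> r \<in> G {x \<in> ?R. w r \<le> w x})"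
    proof (rule exists_greedy_transversal)
      show "finite ?R" using A by simp
      show "finite (G Q) \<and> card Q \<le> card (G Q)" if "Q \<subseteq> ?R" for Q
      proof
        have finQ: "finite Q" using that A finite_subset by blast
        then show "finite (G Q)" unfolding G_def using finS by blast
        have "(\<lambda>x. x mod d) ` Q = (\<lambda>x. x) ` Q"
          by (rule image_cong[OF refl]) (rule Rmod, erule subsetD[OF that])
        then have "card Q = residue_count (int (nat d)) Q" using d by (simp add: residue_count_def)
        also have "\<dots> \<le> residue_count (int (nat d)) (?S Q)"
          using d by (intro residue_count_dil_sum_ge finQ) (simp_all add: Gcd)
        finally show "card Q \<le> card (G Q)" using d by (simp add: G_def residue_count_def)
      qed
      show "G P \<subseteq> G Q" if "P \<subseteq> Q" for P Q
        unfolding G_def using that by (intro image_mono dil_sum_mono)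
    qed
    then obtain \<sigma> where \<sigma>: "inj_on \<sigma> ?R" "\<And>r. r \<in> ?R \<Longrightarrow> \<sigma> r \<in> G {x \<in> ?R. w r \<le> w x}" by blast
    have "\<exists>W\<subseteq>?S A. (\<forall>y\<in>W. y mod d = \<sigma> r) \<and> (\<Sum>l\<leftarrow>ls. \<bar>l\<bar>) * int (w r) \<le> int (card W) + C"
      if r: "r \<in> ?R" for r
    proof -
      obtain z where z: "z \<in> ?S {x \<in> ?R. w r \<le> w x}" "\<sigma> r = z mod d"
        using \<sigma>(2)[OF r] unfolding G_def by blast
      obtain xs where xs: "length xs = length ls" "set xs \<subseteq> {x \<in> ?R. w r \<le> w x}"
        "z = (\<Sum>(l, x)\<leftarrow>zip ls xs. l * x)"
        using mem_dil_sum_const[OF z(1)] by blast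
      have zip: "x \<in> ?R \<and> w r \<le> w x" if "(l, x) \<in> set (zip ls xs)" for l x
        using xs(2) set_zip_rightD[OF that] by blast
      define W where "W = dil_sum (map (\<lambda>(l, x). (l, fibre d A x)) (zip ls xs))"
      define ps where "ps = map (\<lambda>(l, x). (l, B x)) (zip ls xs)"
      \<comment> \<open>\<open>ts\<close> records the offset of each chosen class next to its
        rescaled version; forgetting the offsets gives \<open>ps\<close>, and \<open>W\<close> is an
        affine image of its sum.\<close>
      define ts where "ts = map (\<lambda>(l, x). (l, x mod d, B x)) (zip ls xs)"
      have fsts: "map fst (zip ls xs) = ls" using xs(1) by simp
      have "W \<subseteq> dil_sum (map (\<lambda>(l, x). (l, A)) (zip ls xs))"
        unfolding W_def by (intro dil_sum_mono_zip fibre_subset)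
      also have "map (\<lambda>(l, x). (l, A)) (zip ls xs) = map (\<lambda>l. (l, A)) (map fst (zip ls xs))"
        by (simp add: case_prod_unfold)
      finally have sub: "W \<subseteq> ?S A" unfolding fsts .
      have "map (\<lambda>(l, c, B). (l, (\<lambda>y. c + d * y) ` B)) ts = map (\<lambda>(l, x). (l, fibre d A x)) (zip ls xs)"
        by (simp add: ts_def case_prod_unfold fibre[symmetric])
      moreover have "map (\<lambda>(l, c, B). (l, B)) ts = ps" by (simp add: ts_def ps_def case_prod_unfold)
      moreover have "(\<Sum>(l, c, B)\<leftarrow>ts. l * c) = z"
        unfolding xs(3) ts_def map_map
      proof (intro arg_cong[of _ _ sum_list] map_cong refl)
        fix p assume p: "p \<in> set (zip ls xs)"
        obtain l x where lx: "p = (l, x)" by (metis surj_pair)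
        then show "((\<lambda>(l, c, B). l * c) \<circ> (\<lambda>(l, x). (l, x mod d, B x))) p = (case p of (l, x) \<Rightarrow> l * x)"
          using zip[of l x] p Rmod[of x] by simp
      qed
      ultimately have W: "W = (\<lambda>y. z + d * y) ` dil_sum ps"
        unfolding W_def using dil_sum_affine[of d ts] by simp
      have cW: "card W = card (dil_sum ps)" unfolding W by (rule card_image[OF inj])
      have mod: "\<forall>y\<in>W. y mod d = \<sigma> r" unfolding W z(2) by auto
      have "map fst ps = ls" using fsts by (simp add: ps_def comp_def case_prod_unfold)
      moreover have "\<forall>(l, B)\<in>set ps. finite B \<and> (\<forall>z. \<exists>b\<in>B. b mod int M = z mod int M)"
      proof clarify
        fix l D assume "(l, D) \<in> set ps"
        then obtain x where x: "(l, x) \<in> set (zip ls xs)" "D = B x" unfolding ps_def by auto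
        then have "x \<in> ?R" using zip by blast
        then have "\<exists>b\<in>D. b mod int M = z mod int M" for z
          unfolding x(2) B_def by (rule full_fibre_surj[OF full d])
        then show "finite D \<and> (\<forall>z. \<exists>b\<in>D. b mod int M = z mod int M)" using finB x(2) by blast
      qed
      ultimately have "(\<Sum>(l, B)\<leftarrow>ps. \<bar>l\<bar> div Gcd (set ls) * int (card B)) \<le> int (card (dil_sum ps)) + C"
        using bound by blast
      moreover have "(\<Sum>(l, B)\<leftarrow>ps. \<bar>l\<bar> div Gcd (set ls) * int (card B)) =
          (\<Sum>p\<leftarrow>zip ls xs. \<bar>fst p\<bar> * int (w (snd p)))"
        unfolding ps_def Gcd by (simp add: comp_def case_prod_unfold cB)
      moreover have "(\<Sum>p\<leftarrow>zip ls xs. \<bar>fst p\<bar> * int (w r)) \<le> (\<Sum>p\<leftarrow>zip ls xs. \<bar>fst p\<bar> * int (w (snd p)))"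
        using zip by (intro sum_list_mono mult_left_mono) auto
      moreover have "(\<Sum>p\<leftarrow>zip ls xs. \<bar>fst p\<bar> * int (w r)) = (\<Sum>l\<leftarrow>map fst (zip ls xs). \<bar>l\<bar>) * int (w r)"
        by (simp add: sum_list_mult_const comp_def)
      ultimately have "(\<Sum>l\<leftarrow>ls. \<bar>l\<bar>) * int (w r) \<le> int (card W) + C" unfolding fsts cW by linarith
      then show ?thesis using sub mod by blast
    qed
    then obtain W where W: "\<And>r. r \<in> ?R \<Longrightarrow> W r \<subseteq> ?S A" "\<And>r y. r \<in> ?R \<Longrightarrow> y \<in> W r \<Longrightarrow> y mod d = \<sigma> r"
      "\<And>r. r \<in> ?R \<Longrightarrow> (\<Sum>l\<leftarrow>ls. \<bar>l\<bar>) * int (w r) \<le> int (card (W r)) + C"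
      by metis
    have finW: "finite (W r)" if "r \<in> ?R" for r using W(1)[OF that] finS[OF A] finite_subset by blast
    have "(\<Sum>l\<leftarrow>ls. \<bar>l\<bar>) * int (card A) = (\<Sum>r\<in>?R. (\<Sum>l\<leftarrow>ls. \<bar>l\<bar>) * int (w r))"
      unfolding card_fibre_sum[OF A, of d] w_def by (simp add: sum_distrib_left)
    also have "\<dots> \<le> (\<Sum>r\<in>?R. int (card (W r)) + C)" using W(3) by (intro sum_mono)
    also have "\<dots> = int (\<Sum>r\<in>?R. card (W r)) + C * int (residue_count d A)"
      by (simp add: sum.distrib residue_count_def mult.commute)
    also have "(\<Sum>r\<in>?R. card (W r)) = card (\<Union>r\<in>?R. W r)"
    proof (rule card_UN_disjoint[symmetric])
      show "\<forall>i\<in>?R. \<forall>j\<in>?R. i \<noteq> j \<longrightarrow> W i \<inter> W j = {}"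
        using W(2) \<sigma>(1) unfolding inj_on_def by (metis disjoint_iff)
    qed (use A finW in auto)
    also have "card (\<Union>r\<in>?R. W r) \<le> card (?S A)"
      using W(1) finS[OF A] by (intro card_mono) auto
    finally show ?thesis by simp
  qed
  then show ?thesis using C by blast
qed

section \<open>The lower bound\<close>

text \<open>Only large \<open>A\<close> with \<open>card (?S A) < L * card A\<close> need an
  argument: two of the dilates then yield a small difference set, hence a nearly full-sized
  saturated subset with boundedly many classes. A single coefficient is 1 or -1 and is treated
  directly.\<close>

lemma card_dil_sum_ge_linear:
  fixes ls :: "int list" and \<epsilon> :: real
  assumes ls: "\<forall>l\<in>set ls. l \<noteq> 0" and Gcd: "Gcd (set ls) = 1" and \<epsilon>: "\<epsilon> > 0"
  shows "\<exists>C\<ge>0. \<forall>A. finite A \<longrightarrow>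
    real_of_int (\<Sum>l\<leftarrow>ls. \<bar>l\<bar>) * card A - \<epsilon> * card A - C \<le> card (dil_sum (map (\<lambda>l. (l, A)) ls))"
proof -
  let ?S = "\<lambda>A. dil_sum (map (\<lambda>l. (l, A)) ls)"
  define L where "L = real_of_int (\<Sum>l\<leftarrow>ls. \<bar>l\<bar>)"
  have "ls \<noteq> []" using Gcd by auto
  then consider l where "ls = [l]" | l1 l2 ls' where "ls = l1 # l2 # ls'"
    by (metis neq_Nil_conv)
  then have "\<exists>C\<ge>0. \<forall>A. finite A \<longrightarrow> L * card A - \<epsilon> * card A - C \<le> card (?S A)"
  proof cases
    case 1
    then have "\<bar>l\<bar> = 1" using Gcd by simp
    then have "L = 1" "l \<noteq> 0" using 1 by (auto simp: L_def)
    moreover have "card (?S A) = card A" for A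
      using 1 \<open>l \<noteq> 0\<close> by (simp add: card_elt_set_times flip: set_zero)
    ultimately show ?thesis using \<epsilon> by (intro exI[of _ 0]) simp
  next
    case 2
    have L1: "L \<ge> 1"
    proof -
      have "(\<Sum>l\<leftarrow>ls'. \<bar>l\<bar>) \<ge> 0" by (intro sum_list_nonneg) auto
      moreover have "\<bar>l1\<bar> \<ge> 1" using ls 2 by auto
      ultimately show ?thesis by (simp add: L_def 2)
    qed
    define M where "M = nat (Lcm (set ls))"
    have "Lcm (set ls) \<noteq> 0" using ls by (auto simp: Lcm_0_iff)
    then have LM: "Lcm (set ls) > 0" using Lcm_int_greater_eq_0[of "set ls"] by linarith
    then have M: "M > 0" "\<forall>l\<in>set ls. l \<noteq> 0 \<and> l dvd int M" using ls by (auto simp: M_def dvd_Lcm)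
    \<comment> \<open>Losing a proportion \<open>\<epsilon> / L\<close> of \<open>A\<close> costs
      \<open>\<epsilon> * card A\<close> after multiplication by \<open>L\<close>.\<close>
    have "\<epsilon> / L > 0" using \<epsilon> L1 by simp
    from exists_regular_subset[OF M(1) this, of "L ^ 2"]
    obtain T :: nat where T: "\<forall>A::int set. finite A \<longrightarrow> T < card A \<longrightarrow> card (A + uminus ` A) \<le> L ^ 2 * card A \<longrightarrow>
      (\<exists>d>0. \<exists>A'\<subseteq>A. full d M A' \<and> residue_count d A' \<le> T \<and> (1 - \<epsilon> / L) * card A \<le> card A')" ..
    from card_dil_sum_full_ge[OF \<open>ls \<noteq> []\<close> M(2) Gcd] obtain C0 where C0: "C0 \<ge> 0"
      and full: "\<forall>A d. finite A \<longrightarrow> d > 0 \<longrightarrow> full d M A \<longrightarrow>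
        (\<Sum>l\<leftarrow>ls. \<bar>l\<bar>) * int (card A) \<le> int (card (?S A)) + C0 * int (residue_count d A)"
      by (elim exE conjE)
    \<comment> \<open>The first term absorbs all sets of at most \<open>T\<close> elements, the
      second the error \<open>C0\<close> for each of at most \<open>T\<close> classes.\<close>
    define C where "C = L * real T + real_of_int C0 * real T"
    have CT: "C \<ge> L * real T" "C \<ge> real_of_int C0 * real T" "C \<ge> 0" using C0 L1 by (auto simp: C_def)
    have "L * card A - \<epsilon> * card A - C \<le> card (?S A)" if A: "finite A" for A
    proof -
      have finS: "finite (?S X)" if "finite X" for X using that by (intro finite_dil_sum) auto
      have \<epsilon>A: "\<epsilon> * card A \<ge> 0" using \<epsilon> by simp
      consider "card A \<le> T" | "L * card A \<le> card (?S A)" | "T < card A" "card (?S A) < L * card A"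
        by linarith
      then show ?thesis
      proof cases
        case 1
        then have "L * card A \<le> L * T" using L1 by (intro mult_left_mono) auto
        then show ?thesis using CT \<epsilon>A by linarith
      next
        case 2
        then show ?thesis using CT \<epsilon>A by linarith
      next
        case 3
        have ne: "A \<noteq> {}" using 3 by auto
        have "dil_sum (map (\<lambda>l. (l, A)) ls') \<noteq> {}"
          using ne by (induction ls') (auto simp: set_plus_def elt_set_times_def)
        then have "card (l1 *o A + l2 *o A) \<le> card (l1 *o A + l2 *o A + dil_sum (map (\<lambda>l. (l, A)) ls'))"
          using A by (intro card_plus_mono_left finite_set_plus finite_dil_sum) auto
        also have "\<dots> = card (?S A)" by (simp add: 2 add.assoc)
        finally have "card (l1 *o A + l2 *o A) \<le> L * card A" using 3 by linarith
        then have "card (A + uminus ` A) \<le> L ^ 2 * card A"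
          using ls 2 by (intro card_diff_le_of_dilates[OF A ne, of l1 l2]) auto
        then obtain d A' where A': "d > 0" "A' \<subseteq> A" "full d M A'" "residue_count d A' \<le> T"
          "(1 - \<epsilon> / L) * card A \<le> card A'"
          using T A 3 by blast
        have finA': "finite A'" using A' A finite_subset by blast
        have "L * ((1 - \<epsilon> / L) * card A) \<le> L * card A'" using A' L1 by (intro mult_left_mono) auto
        moreover have "L * ((1 - \<epsilon> / L) * card A) = L * card A - \<epsilon> * card A"
          using L1 by (simp add: field_simps)
        moreover have "L * card A' \<le> card (?S A') + real_of_int C0 * real (residue_count d A')"
        proof -
          have "real_of_int ((\<Sum>l\<leftarrow>ls. \<bar>l\<bar>) * int (card A')) \<le> real_of_int (int (card (?S A')) + C0 * int (residue_count d A'))"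
            using full finA' A' unfolding of_int_le_iff by blast
          then show ?thesis by (simp add: L_def)
        qed
        moreover have "real_of_int C0 * real (residue_count d A') \<le> real_of_int C0 * real T" using C0 A' by (intro mult_left_mono) auto
        moreover have "card (?S A') \<le> card (?S A)"
          using A' finS[OF A] by (intro card_mono dil_sum_mono)
        ultimately show ?thesis using CT by linarith
      qed
    qed
    then show ?thesis using CT by blast
  qed
  then show ?thesis by (simp add: L_def)
qed

section \<open>Zero coefficients and the sublinear error function\<close>

text \<open>For nonempty \<open>A\<close> the dilate by 0 is \<open>{0}\<close>, the neutral element
  of set addition.\<close>

lemma sum_list_dilates_eq:
  fixes A :: "int set"
  assumes "A \<noteq> {}"
  shows "(\<Sum>l\<leftarrow>ls. l *o A) = dil_sum (map (\<lambda>l. (l, A)) (filter (\<lambda>l. l \<noteq> 0) ls))"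
proof (induction ls)
  case (Cons l ls)
  have "0 *o A = 0" using assms by (auto simp: elt_set_times_def set_zero)
  then show ?case using Cons by auto
qed (simp add: set_zero)

text \<open>Turns a loss of \<open>\<epsilon> * n + C\<close> for every \<open>\<epsilon>\<close>
  into one sublinear function: \<open>f n\<close> is the supremum of \<open>g\<close> over the
  objects of size \<open>n\<close>, finite by the linear bound.\<close>

lemma exists_sublinear_majorant:
  fixes g :: "'a \<Rightarrow> real" and c :: "'a \<Rightarrow> nat"
  assumes bdd: "\<And>a. a \<in> X \<Longrightarrow> g a \<le> B * real (c a)"
    and sub: "\<And>\<epsilon>::real. \<epsilon> > 0 \<Longrightarrow> \<exists>C\<ge>0. \<forall>a\<in>X. g a \<le> \<epsilon> * c a + C"
  shows "\<exists>f::nat \<Rightarrow> real. (\<lambda>n. f n / n) \<longlonglongrightarrow> 0 \<and> (\<forall>a\<in>X. g a \<le> f (c a))"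
proof -
  \<comment> \<open>Inserting 0 keeps the set nonempty and makes \<open>f\<close>
    nonnegative.\<close>
  define V where "V = (\<lambda>n. insert 0 (g ` {a \<in> X. c a = n}))"
  define f where "f = (\<lambda>n. Sup (V n))"
  have bddV: "bdd_above (V n)" for n
    using bdd by (intro bdd_aboveI[of _ "max 0 (B * n)"]) (force simp: V_def)
  have f0: "f n \<ge> 0" for n
    unfolding f_def by (rule cSup_upper[OF _ bddV]) (simp add: V_def)
  have "g a \<le> f (c a)" if "a \<in> X" for a
    unfolding f_def using that by (intro cSup_upper[OF _ bddV]) (auto simp: V_def)
  moreover have "(\<lambda>n. f n / n) \<longlonglongrightarrow> 0"
  proof (rule LIMSEQ_I)
    fix e :: real assume e: "e > 0"
    then obtain C where C: "C \<ge> 0" "\<forall>a\<in>X. g a \<le> e / 2 * c a + C" using sub[of "e / 2"] by auto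
    have fn: "f n \<le> e / 2 * real n + C" for n
      unfolding f_def using C e by (intro cSup_least) (auto simp: V_def)
    obtain N :: nat where N: "real N > 2 * C / e" using reals_Archimedean2 by blast
    have "norm (f n / n - 0) < e" if n: "n \<ge> N" for n
    proof -
      have "real n > 2 * C / e" using N n by linarith
      then have Cn: "C < e / 2 * n" using e by (simp add: field_simps)
      then have "n > 0" using C by (cases n) auto
      have "f n < e * n" using fn[of n] Cn by (simp add: field_simps)
      then show ?thesis using f0[of n] \<open>n > 0\<close> by (simp add: field_simps)
    qed
    then show "\<exists>N. \<forall>n\<ge>N. norm (f n / n - 0) < e" by blast
  qed
  ultimately show ?thesis by blast
qed

theorem theorem2:
  fixes k :: nat and lams :: "int list"
  assumes "k \<ge> 1" and "length lams = k" and "Gcd (set lams) = 1"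
  shows "\<exists>f :: nat \<Rightarrow> real.
    (\<lambda>n. f n / real n) \<longlonglongrightarrow> 0 \<and>
    (\<forall>A :: int set. finite A \<longrightarrow>
      real (card (\<Sum>l\<leftarrow>lams. l *o A))
        \<ge> real_of_int (\<Sum>l\<leftarrow>lams. \<bar>l\<bar>) * real (card A) - f (card A))"
proof -
  let ?S = "\<lambda>A::int set. (\<Sum>l\<leftarrow>lams. l *o A)"
  define ls where "ls = filter (\<lambda>l. l \<noteq> 0) lams"
  define L where "L = real_of_int (\<Sum>l\<leftarrow>lams. \<bar>l\<bar>)"
  have "set lams = set ls \<or> set lams = insert 0 (set ls)" by (auto simp: ls_def)
  then have Gcd: "Gcd (set ls) = 1" using assms(3) by auto
  have "(\<Sum>l\<leftarrow>lams. \<bar>l\<bar>) = (\<Sum>l\<leftarrow>ls. \<bar>l\<bar>)"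
    unfolding ls_def by (induction lams) auto
  then have L: "L = real_of_int (\<Sum>l\<leftarrow>ls. \<bar>l\<bar>)" by (simp add: L_def)
  have "\<exists>f::nat \<Rightarrow> real. (\<lambda>n. f n / n) \<longlonglongrightarrow> 0 \<and>
    (\<forall>A\<in>{A. finite A}. L * card A - card (?S A) \<le> f (card A))"
  \<comment> \<open>The error function dominates the deficit
    \<open>L * card A - card (?S A)\<close>, which is trivially at most
    \<open>L * card A\<close>.\<close>
  proof (rule exists_sublinear_majorant)
    show "L * card A - card (?S A) \<le> L * card A" for A :: "int set" by simp
    fix \<epsilon> :: real assume "\<epsilon> > 0"
    then obtain C where C: "C \<ge> 0" "\<And>A. finite A \<Longrightarrow>
        L * card A - \<epsilon> * card A - C \<le> card (dil_sum (map (\<lambda>l. (l, A)) ls))"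
      using card_dil_sum_ge_linear[OF _ Gcd] unfolding L ls_def by auto
    have "L * card A - card (?S A) \<le> \<epsilon> * card A + C" if "finite A" for A :: "int set"
    proof (cases "A = {}")
      case False
      then show ?thesis using C(2)[OF that] unfolding sum_list_dilates_eq[OF False] ls_def by linarith
    qed (use C in simp)
    then show "\<exists>C\<ge>0. \<forall>A\<in>{A. finite A}. L * card A - card (?S A) \<le> \<epsilon> * card A + C" using C(1) by blast
  qed
  then obtain f :: "nat \<Rightarrow> real" where f: "(\<lambda>n. f n / n) \<longlonglongrightarrow> 0"
    "\<And>A. finite A \<Longrightarrow> L * card A - card (?S A) \<le> f (card A)" by blast
  show ?thesis
  proof (intro exI[of _ f] conjI allI impI)
    fix A :: "int set" assume "finite A"
    then show "real_of_int (\<Sum>l\<leftarrow>lams. \<bar>l\<bar>) * real (card A) - f (card A) \<le> real (card (?S A))"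
      using f(2)[of A] unfolding L_def by linarith
  qed (rule f(1))
qed

end
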